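(* Suppose $\lambda<q\mu$ and that all customers always choose to join and never renege. Then, in the stationary regime, the expected total sojourn time of a tagged customer who joins at position $i$ ($i=1,2,\ldots$) is $$w^{(\infty)}_{i,i}=\mathbb E\left(W^{(\infty)}\mid \xi=i\right)=\frac{i+1-q}{(q-1)\lambda-(q-2)q\mu}.$$
   Context: Single-server first-come-first-served queue with parameters $\lambda,\mu>0$, $0<q<1$: Poisson arrivals of rate $\lambda$, i.i.d. exponential($\mu$) services. After each service a customer departs the system with probability $q$, and otherwise (probability $1-q$, independently of everything else) immediately rejoins the end of the queue to be served again, repeatedly until success. $\xi$ denotes the position at which the tagged customer joins on arrival, i.e. the number of customers in the system just after she joins, counting herself ($\xi=1$ means she immediately enters service). $W^{(\infty)}$ is her total sojourn time, from arrival to final departure (waiting plus all services), when all other arriving customers always join and nobody reneges. *)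

theory Defs
  imports "HOL-Probability.Probability"
begin

datatype customer = Tagged | Other

text \<open>
  Time is measured from the arrival of the tagged customer, who finds \<open>n\<close> customers in the system.
  She joins at the end of the line, so the server is busy until she departs, and up to then the
  completed services follow each other without gaps: with service durations \<open>s 0, s 1, \<dots>\<close>, the
  \<open>k\<close>-th one (counting from 0) occupies the time interval from \<open>service_start s k\<close> to
  \<open>service_start s (Suc k)\<close>.  Here \<open>s 0\<close> is the residual duration of the service in progress at her
  arrival (her own first service, if \<open>n = 0\<close>).
\<close>

definition service_start :: "(nat \<Rightarrow> real) \<Rightarrow> nat \<Rightarrow> real" where
  "service_start s k = (\<Sum>l<k. s l)"

text \<open>\<open>a m\<close> are the interarrival times, \<open>a 0\<close> being the time until the first later arrival.\<close>

definition arrival_epoch :: "(nat \<Rightarrow> real) \<Rightarrow> nat \<Rightarrow> real" where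
  "arrival_epoch a m = (\<Sum>l\<le>m. a l)"

definition arrivals_during :: "(nat \<Rightarrow> real) \<Rightarrow> (nat \<Rightarrow> real) \<Rightarrow> nat \<Rightarrow> nat" where
  "arrivals_during a s k =
     card {m. service_start s k < arrival_epoch a m \<and> arrival_epoch a m \<le> service_start s (Suc k)}"

text \<open>
  The line at the start of the \<open>k\<close>-th service, head in service.  The customers who arrive during a
  service are ahead of the customer who rejoins at its completion.  \<open>d k\<close> says that the
  \<open>k\<close>-th service ends in a departure from the system.  The equations describe the queue only as long
  as the tagged customer is present, and they are used only that long.
\<close>

primrec line :: "nat \<Rightarrow> (nat \<Rightarrow> real) \<Rightarrow> (nat \<Rightarrow> real) \<Rightarrow> (nat \<Rightarrow> bool) \<Rightarrow> nat \<Rightarrow> customer list" where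
  "line n a s d 0 = replicate n Other @ [Tagged]"
| "line n a s d (Suc k) =
     (case line n a s d k of
        [] \<Rightarrow> []
      | c # cs \<Rightarrow> cs @ replicate (arrivals_during a s k) Other @ (if d k then [] else [c]))"

definition tagged_departs_at :: "nat \<Rightarrow> (nat \<Rightarrow> real) \<Rightarrow> (nat \<Rightarrow> real) \<Rightarrow> (nat \<Rightarrow> bool) \<Rightarrow> nat \<Rightarrow> bool" where
  "tagged_departs_at n a s d k \<longleftrightarrow> (\<exists>cs. line n a s d k = Tagged # cs) \<and> d k"

text \<open>At most one \<open>k\<close> qualifies; the value is \<open>\<infinity>\<close> if she never departs.\<close>

definition sojourn_time :: "nat \<Rightarrow> (nat \<Rightarrow> real) \<Rightarrow> (nat \<Rightarrow> real) \<Rightarrow> (nat \<Rightarrow> bool) \<Rightarrow> ennreal" where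
  "sojourn_time n a s d =
     (INF k\<in>{k. tagged_departs_at n a s d k}. ennreal (service_start s (Suc k)))"

text \<open>
  Transition rates of the number of customers in the system.  A service completion changes it only
  when the customer departs, hence the death rate \<open>q * mu\<close>.
\<close>

definition queue_rate :: "real \<Rightarrow> real \<Rightarrow> real \<Rightarrow> nat \<Rightarrow> nat \<Rightarrow> real" where
  "queue_rate lam mu q m n =
     (if n = Suc m then lam else if m = Suc n then q * mu else 0)"

text \<open>Global balance; the sets of states exchanging positive rate with \<open>n\<close> lie in \<open>{..Suc n}\<close>.\<close>

definition stationary_queue_length :: "real \<Rightarrow> real \<Rightarrow> real \<Rightarrow> nat pmf \<Rightarrow> bool" where
  "stationary_queue_length lam mu q p \<longleftrightarrow>
     (\<forall>n. pmf p n * (\<Sum>m\<le>Suc n. queue_rate lam mu q n m) =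
          (\<Sum>m\<le>Suc n. pmf p m * queue_rate lam mu q m n))"

datatype primitive = Found | Interarrival nat | Service nat | Departure nat

text \<open>
  \<open>N\<close> is the number of customers found by the tagged customer; as arrivals are Poisson, it has the
  stationary law of the number in the system.  The family in \<open>indep\<close> encodes all primitives as
  real random variables, since independence is stated for a family of one type.
\<close>

locale stationary_feedback_queue = prob_space M for M :: "'a measure" +
  fixes lam mu q :: real
    and N :: "'a \<Rightarrow> nat"
    and A :: "nat \<Rightarrow> 'a \<Rightarrow> real"
    and S :: "nat \<Rightarrow> 'a \<Rightarrow> real"
    and D :: "nat \<Rightarrow> 'a \<Rightarrow> bool"
  assumes indep: "indep_vars (\<lambda>_. borel)
      (\<lambda>i \<omega>. case i of
          Found \<Rightarrow> real (N \<omega>)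
        | Interarrival m \<Rightarrow> A m \<omega>
        | Service k \<Rightarrow> S k \<omega>
        | Departure k \<Rightarrow> of_bool (D k \<omega>)) UNIV"
    and interarrival: "\<And>m. distributed M lborel (A m) (exponential_density lam)"
    and service: "\<And>k. distributed M lborel (S k) (exponential_density mu)"
    and departure: "\<And>k. prob {\<omega> \<in> space M. D k \<omega>} = q"
    and stationary: "\<exists>p. stationary_queue_length lam mu q p \<and>
      (\<forall>n. prob {\<omega> \<in> space M. N \<omega> = n} = pmf p n)"

definition joining_position :: "('a \<Rightarrow> nat) \<Rightarrow> 'a \<Rightarrow> nat" where
  "joining_position N \<omega> = N \<omega> + 1"

definition sojourn ::
    "('a \<Rightarrow> nat) \<Rightarrow> (nat \<Rightarrow> 'a \<Rightarrow> real) \<Rightarrow> (nat \<Rightarrow> 'a \<Rightarrow> real) \<Rightarrow> (nat \<Rightarrow> 'a \<Rightarrow> bool) \<Rightarrow> 'a \<Rightarrow> ennreal" where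
  "sojourn N A S D \<omega> =
     sojourn_time (N \<omega>) (\<lambda>m. A m \<omega>) (\<lambda>k. S k \<omega>) (\<lambda>k. D k \<omega>)"

text \<open>The expectation of \<open>X\<close> under the conditional probability measure given the event \<open>E\<close>.\<close>

definition cond_expectation_event :: "'a measure \<Rightarrow> ('a \<Rightarrow> ennreal) \<Rightarrow> 'a set \<Rightarrow> ennreal" where
  "cond_expectation_event M X E = (\<integral>\<^sup>+ \<omega>. X \<omega> \<partial>uniform_measure M E)"

end

theory Submission
  imports Defs
begin

text \<open>
  While the tagged customer is present, the line is determined by the pair \<open>(j, b)\<close> of the numbers of
  customers ahead of her and behind her. A service that is not hers moves \<open>(j, b)\<close> to
  \<open>(j - 1, b + c + r)\<close>, where \<open>c\<close> counts the arrivals during it and \<open>r\<close> is 1 if the served customer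
  rejoins; an unsuccessful service of her own moves \<open>(0, b)\<close> to \<open>(b + c, 0)\<close>.

  The mean of \<open>c\<close> is \<open>lam / mu\<close> whatever the past of the line (\<open>mean_joined\<close>). Hence an affine function
  \<open>\<alpha> j + \<beta> b + \<gamma>\<close> of the state has an affine conditional expectation after one service, separately
  for \<open>j > 0\<close> and \<open>j = 0\<close>, and the coefficients can be chosen so that it drops by exactly the mean
  service time \<open>1 / mu\<close> at every service: \<open>\<alpha> = 1 / ((q - 1) lam - (q - 2) q mu)\<close>,
  \<open>\<beta> = (1 - q) \<alpha>\<close>, \<open>\<gamma> = (2 - q) \<alpha>\<close> (\<open>remaining_step\<close>). Summing over the services,
  \<open>1 / mu\<close> times the expected number of services begun in her presence equals the initial value
  \<open>\<alpha> (i - 1) + \<gamma> = \<alpha> (i + 1 - q)\<close>, provided that the expected value of the affine function tends to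
  zero (\<open>suminf_present\<close>). By independence of the \<open>k\<close>-th service time from her presence at its start,
  the left-hand side is the expected sojourn time (Wald's identity, \<open>nn_integral_total_service\<close>).

  Convergence to zero (\<open>remaining_tendsto_0\<close>) follows from a pathwise bound. From state \<open>(j, b)\<close> she certainly
  sees \<open>j + 1\<close> services begin from then on, and at the beginning of her own one at least \<open>b\<close> customers stand
  behind her. So the affine function at time \<open>k\<close> is at most \<open>\<gamma>\<close> times the tail, from \<open>k\<close> on, of the
  series of the terms ``present'' plus ``number behind her while she is in service''. Both series have a
  finite expectation: the first by the nonnegativity of the affine function, the second because
  \<open>j + b\<close> loses on average a fraction \<open>q\<close> of \<open>b\<close> at each of her services (\<open>crowd_step\<close>).

  The mean of \<open>c\<close> is obtained directly from the exponential variables. If exactly \<open>m\<close> customers have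
  arrived before the \<open>k\<close>-th service begins, at time \<open>u\<close>, the arrival with index \<open>m + l\<close>, counted
  from 0, falls into that service with conditional probability \<open>exp (- mu (t - u))\<close> given its arrival
  time \<open>t\<close>. Integrating out the interarrival times one by one, the first of them by lack of memory,
  gives \<open>(lam / (lam + mu)) ^ (l + 1)\<close>, and the geometric series over \<open>l\<close> sums to \<open>lam / mu\<close>.
\<close>

section \<open>Exponential integrals and an extended real series\<close>

text \<open>
  With \<open>c = 0\<close> this is the tail probability, with \<open>u = 0\<close> the Laplace transform; the mixed case is the
  Laplace transform of the overshoot over \<open>u\<close>, which by lack of memory factors into the two.
\<close>
lemma nn_integral_exponential_tail:
  fixes l c u :: real
  assumes "0 < l" and "0 \<le> c" and "0 \<le> u"
  shows "(\<integral>\<^sup>+y. indicator {u..} y * ennreal (exp (- c * (y - u))) \<partial>density lborel (exponential_density l))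
           = ennreal (l / (l + c)) * ennreal (exp (- l * u))" (is ?closed)
    and "(\<integral>\<^sup>+y. indicator {u<..} y * ennreal (exp (- c * (y - u))) \<partial>density lborel (exponential_density l))
           = ennreal (l / (l + c)) * ennreal (exp (- l * u))" (is ?opened)
proof -
  have pos: "0 < l + c" using assms by simp
  have "(\<integral>\<^sup>+y. indicator {u..} y * ennreal (exp (- c * (y - u))) \<partial>density lborel (exponential_density l))
      = (\<integral>\<^sup>+y. ennreal (l * exp (c * u - (l + c) * y)) * indicator {u..} y \<partial>lborel)"
    using assms
    by (subst nn_integral_density)
       (auto intro!: nn_integral_cong simp: exponential_density_def ennreal_mult'[symmetric]
          exp_add[symmetric] algebra_simps split: split_indicator)
  also have "\<dots> = ennreal (0 - (- (l / (l + c)) * exp (c * u - (l + c) * u)))"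
  proof (rule nn_integral_FTC_atLeast
      [where F = "\<lambda>y. - (l / (l + c)) * exp (c * u - (l + c) * y)"])
    fix y assume "u \<le> y"
    show "((\<lambda>y. - (l / (l + c)) * exp (c * u - (l + c) * y)) has_real_derivative
        l * exp (c * u - (l + c) * y)) (at y)"
      using pos by (auto intro!: derivative_eq_intros simp: divide_simps) (simp add: algebra_simps)
    show "0 \<le> l * exp (c * u - (l + c) * y)" using assms by simp
  next
    have "filterlim (\<lambda>y. (l + c) * y) at_top at_top"
      using pos by (intro filterlim_tendsto_pos_mult_at_top[OF tendsto_const] filterlim_ident) auto
    then have "filterlim (\<lambda>y. - c * u + (l + c) * y) at_top at_top"
      by (intro filterlim_tendsto_add_at_top[OF tendsto_const])
    then have "filterlim (\<lambda>y. - (- c * u + (l + c) * y)) at_bot at_top"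
      by (simp only: filterlim_uminus_at_top[symmetric])
    then have "((\<lambda>y. exp (- (- c * u + (l + c) * y))) \<longlongrightarrow> 0) at_top"
      by (rule filterlim_compose[OF exp_at_bot])
    then show "((\<lambda>y. - (l / (l + c)) * exp (c * u - (l + c) * y)) \<longlongrightarrow> 0) at_top"
      by (intro tendsto_mult_right_zero) simp
  qed simp
  also have "\<dots> = ennreal (l / (l + c)) * ennreal (exp (- l * u))"
    using assms pos by (simp add: ennreal_mult'[symmetric] algebra_simps)
  finally show ?closed .
  have "AE y in density lborel (exponential_density l). y \<noteq> u"
    by (auto simp: AE_density AE_lborel_singleton intro: eventually_mono[OF AE_lborel_singleton])
  then have "(\<integral>\<^sup>+y. indicator {u<..} y * ennreal (exp (- c * (y - u))) \<partial>density lborel (exponential_density l))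
      = (\<integral>\<^sup>+y. indicator {u..} y * ennreal (exp (- c * (y - u))) \<partial>density lborel (exponential_density l))"
    by (intro nn_integral_cong_AE) (auto elim!: eventually_mono split: split_indicator)
  with \<open>?closed\<close> show ?opened by simp
qed

lemma AE_exponential_pos: "AE y in density lborel (exponential_density l). (0::real) < y"
  by (auto simp: AE_density exponential_density_def intro: eventually_mono[OF AE_lborel_singleton[of 0]])

lemma nn_integral_exponential_mean:
  fixes l :: real
  assumes "0 < l"
  shows "(\<integral>\<^sup>+y. ennreal y \<partial>density lborel (exponential_density l)) = ennreal (1 / l)"
proof -
  have "(\<integral>\<^sup>+y. ennreal y \<partial>density lborel (exponential_density l))
      = (\<integral>\<^sup>+y. ennreal (exponential_density l y * y ^ 1) \<partial>lborel)"
    using assms by (subst nn_integral_density)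
      (auto intro!: nn_integral_cong simp: exponential_density_def ennreal_mult')
  also have "\<dots> = ennreal (1 / l)"
    using nn_integral_erlang_ith_moment[OF assms, of 0 1] by simp
  finally show ?thesis .
qed

lemma ennreal_suminf_tail:
  fixes c :: "nat \<Rightarrow> ennreal"
  assumes fin: "suminf c \<noteq> \<top>"
  shows "(\<lambda>k. \<Sum>l. c (l + k)) \<longlonglongrightarrow> 0"
proof -
  have tail: "(\<Sum>l. c (l + k)) = suminf c - sum c {..<k}" for k
  proof -
    have "sum c {..<k} \<le> suminf c" by (rule sum_le_suminf) simp_all
    then have "sum c {..<k} \<noteq> \<top>" using fin by (metis top_unique)
    then have "(\<Sum>l. c (l + k)) + sum c {..<k} - sum c {..<k} = (\<Sum>l. c (l + k))"
      by (rule ennreal_add_diff_cancel_right)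
    then show ?thesis using suminf_offset[of c k] by simp
  qed
  have "(\<lambda>k. suminf c - sum c {..<k}) \<longlonglongrightarrow> suminf c - suminf c"
    using fin by (intro tendsto_diff_ennreal tendsto_const summable_LIMSEQ) simp_all
  then show ?thesis unfolding tail using fin by (simp add: diff_eq_0_iff_ennreal less_top)
qed

section \<open>The line as seen by the tagged customer\<close>

text \<open>
  The state \<open>Some (j, b)\<close> means that the tagged customer is present with \<open>j\<close> customers ahead of her and
  \<open>b\<close> behind her; \<open>None\<close> means that she has departed.
\<close>
definition service_step :: "(nat \<times> nat) option \<Rightarrow> nat \<Rightarrow> bool \<Rightarrow> (nat \<times> nat) option" where
  "service_step \<sigma> c leaves = (case \<sigma> of
       None \<Rightarrow> None
     | Some (j, b) \<Rightarrow>
         if 0 < j then Some (j - 1, b + c + of_bool (\<not> leaves))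
         else if leaves then None else Some (b + c, 0))"

primrec place :: "nat \<Rightarrow> (nat \<Rightarrow> nat) \<Rightarrow> (nat \<Rightarrow> bool) \<Rightarrow> nat \<Rightarrow> (nat \<times> nat) option" where
  "place n c d 0 = Some (n, 0)"
| "place n c d (Suc k) = service_step (place n c d k) (c k) (d k)"

lemma service_step_None [simp]: "service_step None c leaves = None"
  by (simp add: service_step_def)

lemma place_cong:
  assumes "\<And>j. j < k \<Longrightarrow> c j = c' j" and "\<And>j. j < k \<Longrightarrow> d j = d' j"
  shows "place n c d k = place n c' d' k"
  using assms by (induction k) auto

lemma line_place:
  "case place n (arrivals_during a s) d k of
     None \<Rightarrow> set (line n a s d k) \<subseteq> {Other}
   | Some (j, b) \<Rightarrow> line n a s d k = replicate j Other @ Tagged # replicate b Other"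
proof (induction k)
  case (Suc k)
  show ?case
  proof (cases "place n (arrivals_during a s) d k")
    case None
    with Suc have "set (line n a s d k) \<subseteq> {Other}" by simp
    then show ?thesis using None by (cases "line n a s d k") auto
  next
    case (Some jb)
    obtain j b where jb: "jb = (j, b)" by fastforce
    show ?thesis
    proof (cases j)
      case 0
      with Suc Some jb show ?thesis
        by (auto simp: service_step_def replicate_add)
    next
      case (Suc j')
      have "replicate m Other @ [Other] = Other # replicate m Other" for m
        by (rule replicate_append_same)
      then show ?thesis using Suc.IH Some jb Suc
        by (auto simp: service_step_def replicate_add)
    qed
  qed
qed simp

lemma tagged_departs_at_iff:
  "tagged_departs_at n a s d k \<longleftrightarrow> (\<exists>b. place n (arrivals_during a s) d k = Some (0, b)) \<and> d k"
proof (cases "place n (arrivals_during a s) d k")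
  case None
  then show ?thesis using line_place[of n a s d k] by (auto simp: tagged_departs_at_def)
next
  case (Some jb)
  obtain j b where "jb = (j, b)" by fastforce
  then show ?thesis using line_place[of n a s d k] Some
    by (cases j) (auto simp: tagged_departs_at_def)
qed

lemma place_None_mono: "place n c d k = None \<Longrightarrow> k \<le> l \<Longrightarrow> place n c d l = None"
  by (induction l) (auto simp: le_Suc_eq)

text \<open>
  Turns the infimum into a series whose terms can be integrated separately. If she never departs, the
  infimum is infinite while the series may converge, hence the second assumption.
\<close>
lemma sojourn_time_eq_suminf:
  assumes s: "\<And>k. 0 \<le> s k" and gone: "place n (arrivals_during a s) d K = None"
  shows "sojourn_time n a s d
    = (\<Sum>k. ennreal (s k) * of_bool (place n (arrivals_during a s) d k \<noteq> None))"
proof -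
  let ?p = "place n (arrivals_during a s) d"
  \<comment> \<open>The first service at whose beginning she is absent; the previous one is her last.\<close>
  define L where "L = (LEAST k. ?p k = None)"
  have L: "?p L = None" unfolding L_def by (rule LeastI[of _ K]) (rule gone)
  have below: "?p k \<noteq> None" if "k < L" for k
    using not_less_Least[of k "\<lambda>k. ?p k = None"] that unfolding L_def by simp
  then obtain k where Lk: "L = Suc k" using L by (cases L) simp_all
  have alive: "?p l \<noteq> None \<longleftrightarrow> l \<le> k" for l
    using below[of l] place_None_mono[OF L, of l] unfolding Lk less_Suc_eq_le not_less_eq_eq[symmetric]
    by (cases "l \<le> k") simp_all
  have "?p k \<noteq> None" "?p (Suc k) = None" using L Lk alive[of k] by simp_all
  then have at_k: "tagged_departs_at n a s d k"
    by (cases "?p k") (auto simp: tagged_departs_at_iff service_step_def split: if_splits)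
  have "l = k" if "tagged_departs_at n a s d l" for l
  proof -
    have "?p l \<noteq> None" "?p (Suc l) = None"
      using that by (auto simp: tagged_departs_at_iff service_step_def)
    then show ?thesis using alive[of l] alive[of "Suc l"] by linarith
  qed
  with at_k have "{k. tagged_departs_at n a s d k} = {k}" by blast
  then have "sojourn_time n a s d = ennreal (\<Sum>l<Suc k. s l)"
    by (simp add: sojourn_time_def service_start_def)
  also have "\<dots> = (\<Sum>l<Suc k. ennreal (s l))"
    using s by (intro sum_ennreal[symmetric]) simp
  also have "\<dots> = (\<Sum>l<Suc k. ennreal (s l) * of_bool (?p l \<noteq> None))"
    by (intro sum.cong refl) (simp only: alive, simp)
  also have "\<dots> = (\<Sum>l. ennreal (s l) * of_bool (?p l \<noteq> None))"
    by (intro suminf_finite[symmetric]) (simp_all only: alive, simp_all)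
  finally show ?thesis .
qed

text \<open>The candidates for the expected remaining time.\<close>
definition linear_cost :: "real \<Rightarrow> real \<Rightarrow> real \<Rightarrow> (nat \<times> nat) option \<Rightarrow> ennreal" where
  "linear_cost \<alpha> \<beta> \<gamma> \<sigma> = (case \<sigma> of None \<Rightarrow> 0 | Some (j, b) \<Rightarrow> ennreal (\<alpha> * real j + \<beta> * real b + \<gamma>))"

definition present :: "(nat \<times> nat) option \<Rightarrow> ennreal" where
  "present \<sigma> = of_bool (\<sigma> \<noteq> None)"

definition behind_head :: "(nat \<times> nat) option \<Rightarrow> ennreal" where
  "behind_head \<sigma> = (case \<sigma> of Some (0, b) \<Rightarrow> of_nat b | _ \<Rightarrow> 0)"

lemma place_while_ahead:
  assumes "place n c d k = Some (j, b)" and "l \<le> j"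
  shows "\<exists>b'\<ge>b. place n c d (l + k) = Some (j - l, b')"
  using \<open>l \<le> j\<close>
proof (induction l)
  case (Suc l)
  then obtain b' where "b \<le> b'" "place n c d (l + k) = Some (j - l, b')" by auto
  with Suc.prems show ?case by (auto simp: service_step_def)
qed (use assms in auto)

text \<open>
  From state \<open>(j, b)\<close>, each of the next \<open>j + 1\<close> services begins in her presence, and the last of these
  is her own, with at least \<open>b\<close> customers behind her. As \<open>\<gamma>\<close> dominates all coefficients, the cost
  is at most \<open>\<gamma> (j + 1 + b)\<close>, so it is controlled by the tail of a series.
\<close>
lemma linear_cost_le_future:
  assumes "0 \<le> \<alpha>" "\<alpha> \<le> \<gamma>" "\<beta> \<le> \<gamma>"
  shows "linear_cost \<alpha> \<beta> \<gamma> (place n c d k)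
    \<le> ennreal \<gamma> * (\<Sum>l. present (place n c d (l + k)) + behind_head (place n c d (l + k)))"
proof (cases "place n c d k")
  case (Some jb)
  obtain j b where jb: "jb = (j, b)" by fastforce
  let ?f = "\<lambda>l. present (place n c d (l + k)) + behind_head (place n c d (l + k))"
  have later: "\<exists>b'\<ge>b. place n c d (l + k) = Some (j - l, b')" if "l \<le> j" for l
    using place_while_ahead[of n c d k j b l] Some jb that by simp
  have f: "1 \<le> ?f l" if "l < j" for l
    using later[of l] that by (auto simp: present_def intro: add_increasing2)
  have fj: "1 + of_nat b \<le> ?f j"
    using later[of j] by (auto simp: present_def behind_head_def)
  have "\<alpha> * real j + \<beta> * real b + \<gamma> \<le> \<gamma> * (real j + (1 + real b))"
    using mult_right_mono[OF assms(2), of "real j"] mult_right_mono[OF assms(3), of "real b"]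
    by (simp add: algebra_simps)
  then have "linear_cost \<alpha> \<beta> \<gamma> (place n c d k) \<le> ennreal (\<gamma> * (real j + (1 + real b)))"
    using Some jb by (simp add: linear_cost_def ennreal_leI)
  also have "\<dots> = ennreal \<gamma> * ((\<Sum>l<j. 1) + (1 + of_nat b))"
    using assms by (simp add: ennreal_mult' ennreal_of_nat_eq_real_of_nat)
  also have "(\<Sum>l<j. 1) + (1 + of_nat b) \<le> (\<Sum>l<j. ?f l) + ?f j"
    using f by (intro add_mono[OF sum_mono fj]) simp
  also have "\<dots> = (\<Sum>l<Suc j. ?f l)" by simp
  also have "\<dots> \<le> (\<Sum>l. ?f l)" by (intro sum_le_suminf) auto
  finally show ?thesis by (simp add: mult_left_mono)
qed (simp add: linear_cost_def)

section \<open>Counting arrivals along one path\<close>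

text \<open>
  Counts only the first \<open>m\<close> later arrivals, so that it does not depend on \<open>a l\<close> for \<open>l \<ge> m\<close>; it agrees
  with \<open>arrivals_during\<close> on services completed before the arrival with index \<open>m\<close>.
\<close>
definition arrivals_among :: "nat \<Rightarrow> (nat \<Rightarrow> real) \<Rightarrow> (nat \<Rightarrow> real) \<Rightarrow> nat \<Rightarrow> nat" where
  "arrivals_among m a s k =
     card {i. i < m \<and> service_start s k < arrival_epoch a i \<and> arrival_epoch a i \<le> service_start s (Suc k)}"

locale arrival_path =
  fixes a :: "nat \<Rightarrow> real"
  assumes pos: "0 < a m" and unbounded: "\<exists>m. u < (\<Sum>l<m. a l)"
begin

lemma partial_sum_mono: "m \<le> m' \<Longrightarrow> (\<Sum>l<m. a l) \<le> (\<Sum>l<m'. a l)"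
  using pos by (intro sum_mono2) (auto intro: less_imp_le)

lemma arrival_epoch_eq: "arrival_epoch a i = (\<Sum>l<Suc i. a l)"
  by (simp add: arrival_epoch_def lessThan_Suc_atMost)

lemma ex1_count:
  assumes "0 \<le> u"
  shows "\<exists>!m. (\<Sum>l<m. a l) \<le> u \<and> u < (\<Sum>l<Suc m. a l)"
proof (rule ex_ex1I)
  define L where "L = (LEAST m. u < (\<Sum>l<m. a l))"
  have L: "u < (\<Sum>l<L. a l)" unfolding L_def by (rule LeastI_ex[OF unbounded])
  then obtain m where m: "L = Suc m" using assms by (cases L) auto
  then have "\<not> u < (\<Sum>l<m. a l)"
    using not_less_Least[of m "\<lambda>m. u < (\<Sum>l<m. a l)"] unfolding L_def by simp
  with L m show "\<exists>m. (\<Sum>l<m. a l) \<le> u \<and> u < (\<Sum>l<Suc m. a l)"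
    by (intro exI[of _ m]) simp
  show "i = j" if "(\<Sum>l<i. a l) \<le> u \<and> u < (\<Sum>l<Suc i. a l)"
    "(\<Sum>l<j. a l) \<le> u \<and> u < (\<Sum>l<Suc j. a l)" for i j
    using that partial_sum_mono[of "Suc i" j] partial_sum_mono[of "Suc j" i] by (cases i j rule: linorder_cases) auto
qed

lemma card_arrivals:
  assumes m: "(\<Sum>l<m. a l) \<le> u" "u < (\<Sum>l<Suc m. a l)"
  shows "ennreal (real (card {i. u < arrival_epoch a i \<and> arrival_epoch a i \<le> v}))
    = (\<Sum>l. of_bool ((\<Sum>i<Suc (m + l). a i) \<le> v))"
proof -
  let ?A = "{l. (\<Sum>i<Suc (m + l). a i) \<le> v}"
  obtain K where K: "v < (\<Sum>l<K. a l)" using unbounded by blast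
  have fin: "finite ?A"
  proof (rule finite_subset)
    show "?A \<subseteq> {..K}"
    proof
      fix l assume "l \<in> ?A"
      then show "l \<in> {..K}" using K partial_sum_mono[of K "Suc (m + l)"] by (cases "l \<le> K") auto
    qed
  qed simp
  have later: "u < arrival_epoch a i \<longleftrightarrow> m \<le> i" for i
    using m partial_sum_mono[of "Suc m" "Suc i"] partial_sum_mono[of "Suc i" m] unfolding arrival_epoch_eq
    by (cases "m \<le> i") auto
  have "{i. u < arrival_epoch a i \<and> arrival_epoch a i \<le> v} = (\<lambda>l. m + l) ` ?A"
  proof (intro set_eqI iffI)
    fix i assume "i \<in> {i. u < arrival_epoch a i \<and> arrival_epoch a i \<le> v}"
    then have "m \<le> i" "(\<Sum>l<Suc i. a l) \<le> v" using later[of i] arrival_epoch_eq[of i] by auto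
    then show "i \<in> (\<lambda>l. m + l) ` ?A" by (intro image_eqI[of _ _ "i - m"]) auto
  next
    fix i assume "i \<in> (\<lambda>l. m + l) ` ?A"
    then obtain l where "i = m + l" "(\<Sum>j<Suc i. a j) \<le> v" by blast
    then show "i \<in> {i. u < arrival_epoch a i \<and> arrival_epoch a i \<le> v}"
      using later[of i] arrival_epoch_eq[of i] by simp
  qed
  then have "card {i. u < arrival_epoch a i \<and> arrival_epoch a i \<le> v} = card ?A"
    by (simp add: card_image)
  moreover have "(\<Sum>l. of_bool ((\<Sum>i<Suc (m + l). a i) \<le> v)) = (\<Sum>l\<in>?A. 1 :: ennreal)"
    using fin by (subst suminf_finite[of ?A]) auto
  ultimately show ?thesis by (simp only: ennreal_of_nat_eq_real_of_nat sum_constant mult_1_right)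
qed

lemma arrivals_among_eq:
  assumes s: "\<And>k. 0 \<le> s k" and m: "service_start s k < (\<Sum>l<Suc m. a l)" and "j < k"
  shows "arrivals_among m a s j = arrivals_during a s j"
proof -
  have "service_start s (Suc j) \<le> service_start s k"
    unfolding service_start_def using s \<open>j < k\<close> by (intro sum_mono2) auto
  then have "i < m" if "arrival_epoch a i \<le> service_start s (Suc j)" for i
    using that m partial_sum_mono[of "Suc m" "Suc i"] unfolding arrival_epoch_eq by (cases "i < m") auto
  then show ?thesis unfolding arrivals_among_def arrivals_during_def
    by (intro arg_cong[of _ _ card]) auto
qed

end

section \<open>The law of the primitives as a product measure\<close>

text \<open>
  The primitives under their joint law are the coordinates of a product space, where independence means
  that each coordinate may be resampled.
\<close>
locale feedback_primitives =
  fixes lam mu q :: real and \<nu> :: "primitive \<Rightarrow> real measure"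
  assumes rates: "0 < lam" "0 < mu" and q: "0 < q" "q < 1"
    and prob_space_\<nu>: "prob_space (\<nu> p)"
    and sets_\<nu>: "sets (\<nu> p) = sets borel"
    and \<nu>_Interarrival: "\<nu> (Interarrival m) = density lborel (exponential_density lam)"
    and \<nu>_Service: "\<nu> (Service k) = density lborel (exponential_density mu)"
    and \<nu>_Departure: "emeasure (\<nu> (Departure k)) {1} = ennreal q"
begin

abbreviation P :: "(primitive \<Rightarrow> real) measure" where
  "P \<equiv> PiM UNIV \<nu>"

abbreviation ia :: "(primitive \<Rightarrow> real) \<Rightarrow> nat \<Rightarrow> real" where
  "ia x \<equiv> \<lambda>m. x (Interarrival m)"

abbreviation srv :: "(primitive \<Rightarrow> real) \<Rightarrow> nat \<Rightarrow> real" where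
  "srv x \<equiv> \<lambda>k. x (Service k)"

abbreviation dep :: "(primitive \<Rightarrow> real) \<Rightarrow> nat \<Rightarrow> bool" where
  "dep x \<equiv> \<lambda>k. x (Departure k) = 1"

abbreviation joined :: "(primitive \<Rightarrow> real) \<Rightarrow> nat \<Rightarrow> nat" where
  "joined x \<equiv> arrivals_during (ia x) (srv x)"

abbreviation tagged_at :: "nat \<Rightarrow> (primitive \<Rightarrow> real) \<Rightarrow> nat \<Rightarrow> (nat \<times> nat) option" where
  "tagged_at n x k \<equiv> place n (joined x) (dep x) k"

sublocale product_prob_space \<nu> UNIV
  by (simp add: product_prob_space_def product_sigma_finite_def product_prob_space_axioms_def
      prob_space_\<nu> prob_space_imp_sigma_finite)

sublocale P: prob_space P
  by (rule prob_space_PiM) (rule prob_space_\<nu>)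

lemma space_P [simp]: "space P = UNIV"
proof -
  have "space (\<nu> p) = UNIV" for p using sets_eq_imp_space_eq[OF sets_\<nu>[of p]] by simp
  then show ?thesis by (simp add: space_PiM)
qed

lemma measurable_coordinate [measurable]: "(\<lambda>x. x p) \<in> borel_measurable P"
  using measurable_component_singleton[of p UNIV \<nu>] measurable_cong_sets[OF refl sets_\<nu>] by blast

lemma measurable_update [measurable]: "(\<lambda>y. x(p := y)) \<in> \<nu> p \<rightarrow>\<^sub>M P"
proof (rule measurable_PiM_single')
  fix i show "(\<lambda>y. (x(p := y)) i) \<in> \<nu> p \<rightarrow>\<^sub>M \<nu> i"
    using sets_eq_imp_space_eq[OF sets_\<nu>[of i]] by (cases "i = p") auto
qed (use sets_eq_imp_space_eq[OF sets_\<nu>] in \<open>auto simp: space_PiM\<close>)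

text \<open>
  The form in which independence is used: replacing one coordinate by a fresh copy does not change the
  expectation. That \<open>g\<close> does not depend on coordinate \<open>p\<close> then reads \<open>g (x(p := y)) = g x\<close>.
\<close>
lemma resample:
  assumes f [measurable]: "f \<in> borel_measurable P"
  shows "(\<integral>\<^sup>+x. f x \<partial>P) = (\<integral>\<^sup>+x. \<integral>\<^sup>+y. f (x(p := y)) \<partial>\<nu> p \<partial>P)"
proof -
  interpret pair_sigma_finite "\<nu> p" P
    by (intro pair_sigma_finite.intro prob_space_imp_sigma_finite prob_space_\<nu> P.prob_space_axioms)
  have upd: "(\<lambda>(y, x). x(p := y)) \<in> \<nu> p \<Otimes>\<^sub>M P \<rightarrow>\<^sub>M P"
    using measurable_compose[OF measurable_pair_swap' measurable_add_dim[of p UNIV \<nu>]]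
    by (simp add: case_prod_unfold)
  have "(\<integral>\<^sup>+x. f x \<partial>P) = (\<integral>\<^sup>+x. f x \<partial>distr (\<nu> p \<Otimes>\<^sub>M P) P (\<lambda>(y, x). x(p := y)))"
    using distr_pair_PiM_eq_PiM[of UNIV \<nu> p] prob_space_\<nu> by simp
  also have "\<dots> = (\<integral>\<^sup>+z. f ((\<lambda>(y, x). x(p := y)) z) \<partial>(\<nu> p \<Otimes>\<^sub>M P))"
    using upd by (subst nn_integral_distr) simp_all
  also have "\<dots> = (\<integral>\<^sup>+x. \<integral>\<^sup>+y. f (x(p := y)) \<partial>\<nu> p \<partial>P)"
    using nn_integral_snd[OF measurable_compose[OF upd f]] by simp
  finally show ?thesis .
qed

lemma resample_factor:
  assumes g [measurable]: "g \<in> borel_measurable P" and h [measurable]: "h \<in> borel_measurable P"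
    and indep: "\<And>x y. g (x(p := y)) = g x"
  shows "(\<integral>\<^sup>+x. g x * h x \<partial>P) = (\<integral>\<^sup>+x. g x * (\<integral>\<^sup>+y. h (x(p := y)) \<partial>\<nu> p) \<partial>P)"
  by (subst resample[of _ p]) (auto simp: indep intro!: nn_integral_cong nn_integral_cmult)

lemma AE_ia_pos: "AE x in P. \<forall>m. 0 < ia x m"
  unfolding AE_all_countable
  by (intro allI AE_PiM_component[where P = "\<lambda>y. 0 < y"] prob_space_\<nu> UNIV_I)
     (simp only: \<nu>_Interarrival, rule AE_exponential_pos)

lemma AE_srv_pos: "AE x in P. \<forall>k. 0 < srv x k"
  unfolding AE_all_countable
  by (intro allI AE_PiM_component[where P = "\<lambda>y. 0 < y"] prob_space_\<nu> UNIV_I)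
     (simp only: \<nu>_Service, rule AE_exponential_pos)

lemma nn_integral_discount:
  assumes "0 \<le> c"
  shows "(\<integral>\<^sup>+y. ennreal (exp (- c * y)) \<partial>\<nu> (Interarrival m)) = ennreal (lam / (lam + c))"
proof -
  have "(\<integral>\<^sup>+y. ennreal (exp (- c * y)) \<partial>\<nu> (Interarrival m))
      = (\<integral>\<^sup>+y. indicator {0..} y * ennreal (exp (- c * (y - 0))) \<partial>\<nu> (Interarrival m))"
    unfolding \<nu>_Interarrival using AE_exponential_pos[of lam]
    by (intro nn_integral_cong_AE) (auto elim!: eventually_mono)
  then show ?thesis
    using nn_integral_exponential_tail(1)[of lam c 0] rates assms by (simp add: \<nu>_Interarrival)
qed

lemma discount_interarrivals:
  assumes [measurable]: "g \<in> borel_measurable P" and "0 \<le> c"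
    and indep: "\<And>x i y. m \<le> i \<Longrightarrow> g (x(Interarrival i := y)) = g x"
  shows "(\<integral>\<^sup>+x. g x * ennreal (exp (- c * (\<Sum>i=m..<m + l. ia x i))) \<partial>P)
    = ennreal (lam / (lam + c)) ^ l * (\<integral>\<^sup>+x. g x \<partial>P)"
proof (induction l)
  case (Suc l)
  let ?e = "\<lambda>x. ennreal (exp (- c * (\<Sum>i=m..<m + l. ia x i)))"
  have "(\<integral>\<^sup>+x. g x * ennreal (exp (- c * (\<Sum>i=m..<m + Suc l. ia x i))) \<partial>P)
      = (\<integral>\<^sup>+x. (g x * ?e x) * ennreal (exp (- c * ia x (m + l))) \<partial>P)"
    by (simp add: ennreal_mult'[symmetric] exp_add[symmetric] algebra_simps)
  also have "\<dots> = (\<integral>\<^sup>+x. (g x * ?e x) * ennreal (lam / (lam + c)) \<partial>P)"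
    using \<open>0 \<le> c\<close>
    by (subst resample_factor[where p = "Interarrival (m + l)"])
       (auto simp: indep nn_integral_discount[simplified])
  also have "\<dots> = ennreal (lam / (lam + c)) ^ Suc l * (\<integral>\<^sup>+x. g x \<partial>P)"
    by (subst nn_integral_multc) (simp_all only: Suc power_Suc, measurable, simp add: mult_ac)
  finally show ?case .
qed simp

text \<open>
  The exponential of minus the \<open>m\<close>-th arrival time has mean \<open>(lam / (lam + 1)) ^ m\<close>, so by Markov's
  inequality it is unlikely that \<open>m\<close> customers arrive by time \<open>K\<close>. Without this, infinitely
  many arrivals during one service could be counted as 0 by the cardinality.
\<close>
lemma AE_unbounded: "AE x in P. \<forall>u. \<exists>m. u < (\<Sum>l<m. ia x l)"
proof -
  let ?\<theta> = "lam / (lam + 1)"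
  have \<theta>: "0 \<le> ?\<theta>" "?\<theta> < 1" using rates by auto
  have "AE x in P. \<exists>m. real K < (\<Sum>l<m. ia x l)" for K :: nat
  proof -
    let ?B = "{x. \<forall>m. (\<Sum>l<m. ia x l) \<le> real K}"
    have B [measurable]: "?B \<in> sets P"
    proof -
      have "{x \<in> space P. \<forall>m. (\<Sum>l<m. ia x l) \<le> real K} \<in> sets P" by measurable
      then show ?thesis by simp
    qed
    have "emeasure P ?B * ennreal (exp (- real K)) \<le> ennreal (?\<theta> ^ m)" for m
    proof -
      have "emeasure P ?B * ennreal (exp (- real K)) = (\<integral>\<^sup>+x. ennreal (exp (- real K)) * indicator ?B x \<partial>P)"
        by (simp add: mult.commute nn_integral_cmult)
      also have "\<dots> \<le> (\<integral>\<^sup>+x. 1 * ennreal (exp (- 1 * (\<Sum>i=0..<0 + m. ia x i))) \<partial>P)"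
        by (intro nn_integral_mono) (auto simp: atLeast0LessThan split: split_indicator)
      also have "\<dots> = ennreal (?\<theta> ^ m)"
        using rates P.emeasure_space_1
        by (subst discount_interarrivals) (auto simp: ennreal_power)
      finally show ?thesis .
    qed
    moreover have "(\<lambda>m. ennreal (?\<theta> ^ m)) \<longlonglongrightarrow> ennreal 0"
      using \<theta> by (intro tendsto_ennrealI LIMSEQ_realpow_zero)
    ultimately have "emeasure P ?B * ennreal (exp (- real K)) \<le> 0"
      by (intro LIMSEQ_le_const[where X = "\<lambda>m. ennreal (?\<theta> ^ m)"]) auto
    then have "emeasure P ?B = 0" by simp
    then show ?thesis
      by (intro AE_I[of _ _ ?B]) (auto simp: not_less B)
  qed
  then have "AE x in P. \<forall>K::nat. \<exists>m. real K < (\<Sum>l<m. ia x l)"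
    by (simp add: AE_all_countable)
  then show ?thesis
    by (rule eventually_mono) (meson order.strict_trans reals_Archimedean2)
qed

lemma AE_arrival_path: "AE x in P. arrival_path (ia x)"
  using AE_ia_pos AE_unbounded by eventually_elim (simp add: arrival_path_def)

lemma measurable_service_start [measurable (raw)]: "(\<lambda>x. service_start (srv x) k) \<in> borel_measurable P"
  unfolding service_start_def by measurable

lemma measurable_arrival_epoch [measurable (raw)]: "(\<lambda>x. arrival_epoch (ia x) m) \<in> borel_measurable P"
  unfolding arrival_epoch_def by measurable

lemma pred_arrival_in_service [measurable]:
  "Measurable.pred P (\<lambda>x. service_start (srv x) k < arrival_epoch (ia x) i)"
  "Measurable.pred P (\<lambda>x. arrival_epoch (ia x) i \<le> service_start (srv x) k)"
  unfolding pred_def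
  by (rule borel_measurable_less borel_measurable_le
      measurable_service_start measurable_arrival_epoch)+

lemma measurable_joined [measurable]: "(\<lambda>x. joined x k) \<in> P \<rightarrow>\<^sub>M count_space UNIV"
  unfolding arrivals_during_def by measurable

lemma measurable_among [measurable]:
  "(\<lambda>x. arrivals_among m (ia x) (srv x) k) \<in> P \<rightarrow>\<^sub>M count_space UNIV"
  unfolding arrivals_among_def by measurable

lemma measurable_place [measurable (raw)]:
  assumes [measurable]: "\<And>j. (\<lambda>x. c x j) \<in> P \<rightarrow>\<^sub>M count_space UNIV"
    "\<And>j. (\<lambda>x. d x j) \<in> P \<rightarrow>\<^sub>M count_space UNIV"
  shows "(\<lambda>x. place n (c x) (d x) k) \<in> P \<rightarrow>\<^sub>M count_space UNIV"
proof (induction k)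
  case (Suc k)
  note [measurable] = this
  show ?case unfolding place.simps by measurable
qed simp

lemma pred_le_service_start [measurable (raw)]:
  "f \<in> borel_measurable P \<Longrightarrow> Measurable.pred P (\<lambda>x. f x \<le> service_start (srv x) k)"
  unfolding pred_def by (rule borel_measurable_le[OF _ measurable_service_start])

lemma measurable_comp_place:
  assumes "\<And>j. (\<lambda>x. c x j) \<in> P \<rightarrow>\<^sub>M count_space UNIV"
  shows "(\<lambda>x. g (place n (c x) (dep x) k)) \<in> P \<rightarrow>\<^sub>M borel"
  by (rule measurable_compose[OF measurable_place]) (use assms in simp_all)

lemma measurable_tagged_at [measurable (raw)]: "(\<lambda>x. g (tagged_at n x k)) \<in> P \<rightarrow>\<^sub>M borel"
  by (rule measurable_comp_place) (rule measurable_joined)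

lemma measurable_tagged_among [measurable (raw)]:
  "(\<lambda>x. g (place n (arrivals_among m (ia x) (srv x)) (dep x) k)) \<in> P \<rightarrow>\<^sub>M borel"
  by (rule measurable_comp_place) (rule measurable_among)

section \<open>The number of arrivals during a service\<close>

lemma service_start_update:
  "j \<le> k \<Longrightarrow> service_start (srv (x(Service k := y))) j = service_start (srv x) j"
  "service_start (srv (x(Interarrival i := y))) j = service_start (srv x) j"
  "service_start (srv (x(Departure i := y))) j = service_start (srv x) j"
  "service_start (srv (x(Found := y))) j = service_start (srv x) j"
  by (auto simp: service_start_def intro!: sum.cong)

lemma arrival_epoch_update:
  "i < m \<Longrightarrow> arrival_epoch (ia (x(Interarrival m := y))) i = arrival_epoch (ia x) i"
  by (auto simp: arrival_epoch_def intro!: sum.cong)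

lemma arrivals_among_update:
  "j < k \<Longrightarrow> arrivals_among m (ia (x(Service k := y))) (srv (x(Service k := y))) j
     = arrivals_among m (ia x) (srv x) j"
  "m \<le> i \<Longrightarrow> arrivals_among m (ia (x(Interarrival i := y))) (srv (x(Interarrival i := y))) j
     = arrivals_among m (ia x) (srv x) j"
  unfolding arrivals_among_def
  by (auto simp: service_start_update arrival_epoch_update simp del: fun_upd_apply
      intro!: arg_cong[of _ _ card]) (auto simp: arrival_epoch_def)

text \<open>
  A function \<open>g\<close> of the state at the \<open>k\<close>-th service, restricted to the event that at least (below: exactly)
  \<open>m\<close> customers have arrived by its start. The truncated counts make the dependence on finitely many
  interarrival times explicit; on the second event they are the true ones.
\<close>
definition at_least_arrived :: "((nat \<times> nat) option \<Rightarrow> ennreal) \<Rightarrow> nat \<Rightarrow> nat \<Rightarrow> nat \<Rightarrow> (primitive \<Rightarrow> real) \<Rightarrow> ennreal" where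
  "at_least_arrived g n k m x = of_bool ((\<Sum>i<m. ia x i) \<le> service_start (srv x) k)
     * g (place n (arrivals_among m (ia x) (srv x)) (dep x) k)"

definition exactly_arrived :: "((nat \<times> nat) option \<Rightarrow> ennreal) \<Rightarrow> nat \<Rightarrow> nat \<Rightarrow> nat \<Rightarrow> (primitive \<Rightarrow> real) \<Rightarrow> ennreal" where
  "exactly_arrived g n k m x = at_least_arrived g n k m x * of_bool (service_start (srv x) k < (\<Sum>i<Suc m. ia x i))"

lemma measurable_at_least_arrived [measurable]: "at_least_arrived g n k m \<in> borel_measurable P"
  unfolding at_least_arrived_def[abs_def] by measurable

lemma measurable_exactly_arrived [measurable]: "exactly_arrived g n k m \<in> borel_measurable P"
  unfolding exactly_arrived_def[abs_def] by measurable

lemma at_least_arrived_update: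
  "at_least_arrived g n k m (x(Service k := y)) = at_least_arrived g n k m x"
  "m \<le> i \<Longrightarrow> at_least_arrived g n k m (x(Interarrival i := y)) = at_least_arrived g n k m x"
proof -
  have "place n (arrivals_among m (ia (x(Service k := y))) (srv (x(Service k := y)))) (dep x) k
      = place n (arrivals_among m (ia x) (srv x)) (dep x) k"
    by (rule place_cong) (auto simp only: arrivals_among_update)
  then show "at_least_arrived g n k m (x(Service k := y)) = at_least_arrived g n k m x"
    using service_start_update(1)[of k k x y] by (simp add: at_least_arrived_def)
  assume "m \<le> i"
  then have "place n (arrivals_among m (ia (x(Interarrival i := y))) (srv (x(Interarrival i := y)))) (dep x) k
      = place n (arrivals_among m (ia x) (srv x)) (dep x) k"
    by (intro place_cong) (auto simp only: arrivals_among_update)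
  moreover have "(\<Sum>j<m. ia (x(Interarrival i := y)) j) = (\<Sum>j<m. ia x j)"
    using \<open>m \<le> i\<close> by (intro sum.cong) auto
  ultimately show "at_least_arrived g n k m (x(Interarrival i := y)) = at_least_arrived g n k m x"
    by (simp add: at_least_arrived_def)
qed

lemma exactly_arrived_update:
  "exactly_arrived g n k m (x(Service k := y)) = exactly_arrived g n k m x"
  "Suc m \<le> i \<Longrightarrow> exactly_arrived g n k m (x(Interarrival i := y)) = exactly_arrived g n k m x"
proof -
  show "exactly_arrived g n k m (x(Service k := y)) = exactly_arrived g n k m x"
    using service_start_update(1)[of k k x y] at_least_arrived_update(1)[of g n k m x y] by (simp add: exactly_arrived_def)
  assume "Suc m \<le> i"
  moreover from this have "(\<Sum>j<Suc m. ia (x(Interarrival i := y)) j) = (\<Sum>j<Suc m. ia x j)"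
    by (intro sum.cong) auto
  ultimately show "exactly_arrived g n k m (x(Interarrival i := y)) = exactly_arrived g n k m x"
    using at_least_arrived_update(2)[of m i g n k x y] by (simp add: exactly_arrived_def)
qed

text \<open>
  Lack of memory for the interarrival time that straddles the start of the \<open>k\<close>-th service. The
  right-hand side depends on \<open>c\<close> only through the factor, so comparing with \<open>c = 0\<close> expresses the
  left-hand side by the integral of \<open>exactly_arrived\<close>.
\<close>
lemma overshoot:
  assumes "0 \<le> c"
  shows "(\<integral>\<^sup>+x. exactly_arrived g n k m x
        * ennreal (exp (- c * ((\<Sum>i<Suc m. ia x i) - service_start (srv x) k))) \<partial>P)
    = ennreal (lam / (lam + c)) * (\<integral>\<^sup>+x. at_least_arrived g n k m x
        * ennreal (exp (- lam * (service_start (srv x) k - (\<Sum>i<m. ia x i)))) \<partial>P)"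
proof -
  let ?u = "\<lambda>x. service_start (srv x) k - (\<Sum>i<m. ia x i)"
  let ?h = "\<lambda>x. indicator {?u x<..} (ia x m) * ennreal (exp (- c * (ia x m - ?u x)))"
  have "(\<lambda>x. if ?u x < ia x m then ennreal (exp (- c * (ia x m - ?u x))) else 0) \<in> borel_measurable P"
    by measurable
  also have "(\<lambda>x. if ?u x < ia x m then ennreal (exp (- c * (ia x m - ?u x))) else 0) = ?h"
    by (auto simp: fun_eq_iff)
  finally have h: "?h \<in> borel_measurable P" .
  have "(\<integral>\<^sup>+x. exactly_arrived g n k m x
        * ennreal (exp (- c * ((\<Sum>i<Suc m. ia x i) - service_start (srv x) k))) \<partial>P)
      = (\<integral>\<^sup>+x. at_least_arrived g n k m x * ?h x \<partial>P)"
    by (intro nn_integral_cong) (auto simp: exactly_arrived_def algebra_simps split: split_indicator)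
  also have "\<dots> = (\<integral>\<^sup>+x. at_least_arrived g n k m x
      * (\<integral>\<^sup>+y. ?h (x(Interarrival m := y)) \<partial>\<nu> (Interarrival m)) \<partial>P)"
    by (rule resample_factor) (use h in \<open>simp_all add: at_least_arrived_update\<close>)
  also have "\<dots> = (\<integral>\<^sup>+x. at_least_arrived g n k m x
      * (ennreal (lam / (lam + c)) * ennreal (exp (- lam * ?u x))) \<partial>P)"
  proof (rule nn_integral_cong)
    fix x
    have u: "?u (x(Interarrival m := y)) = ?u x" for y
      by (auto intro!: sum.cong simp: service_start_update)
    show "at_least_arrived g n k m x * (\<integral>\<^sup>+y. ?h (x(Interarrival m := y)) \<partial>\<nu> (Interarrival m))
        = at_least_arrived g n k m x * (ennreal (lam / (lam + c)) * ennreal (exp (- lam * ?u x)))"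
    proof (cases "0 \<le> ?u x")
      case True
      then show ?thesis unfolding u
        using nn_integral_exponential_tail(2)[of lam c "?u x"] rates assms
        by (simp add: \<nu>_Interarrival)
    qed (simp add: at_least_arrived_def)
  qed
  also have "\<dots> = ennreal (lam / (lam + c)) * (\<integral>\<^sup>+x. at_least_arrived g n k m x * ennreal (exp (- lam * ?u x)) \<partial>P)"
    by (subst nn_integral_cmult[symmetric]) (auto simp: mult_ac)
  finally show ?thesis .
qed

text \<open>
  Conditionally on the history, the number of arrivals during a service exceeds \<open>l\<close> with
  probability \<open>(lam / (lam + mu)) ^ (l + 1)\<close>: first the service time is integrated out, then the later
  interarrival times, and finally the straddling one.
\<close>
lemma joins_during_service:
  "(\<integral>\<^sup>+x. exactly_arrived g n k m x * of_bool ((\<Sum>i<Suc (m + l). ia x i) \<le> service_start (srv x) (Suc k)) \<partial>P)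
    = ennreal (lam / (lam + mu)) ^ Suc l * (\<integral>\<^sup>+x. exactly_arrived g n k m x \<partial>P)"
proof -
  let ?U = "\<lambda>x. service_start (srv x) k" and ?T = "\<lambda>m x. \<Sum>i<m. ia x i"
  let ?e = "\<lambda>m x. ennreal (exp (- mu * (?T m x - ?U x)))"
  let ?h = "\<lambda>x. of_bool (?T (Suc (m + l)) x \<le> service_start (srv x) (Suc k)) :: ennreal"
  \<comment> \<open>Integrating out the service time replaces the event by its probability, an exponential function of
    the remaining time until the arrival.\<close>
  have "(\<integral>\<^sup>+x. exactly_arrived g n k m x * ?h x \<partial>P)
      = (\<integral>\<^sup>+x. exactly_arrived g n k m x * (\<integral>\<^sup>+y. ?h (x(Service k := y)) \<partial>\<nu> (Service k)) \<partial>P)"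
    by (rule resample_factor) (simp_all add: exactly_arrived_update)
  also have "\<dots> = (\<integral>\<^sup>+x. exactly_arrived g n k m x * ?e (Suc (m + l)) x \<partial>P)"
  proof (intro nn_integral_cong_AE eventually_mono[OF AE_ia_pos])
    fix x assume pos: "\<forall>m. 0 < ia x m"
    let ?t = "?T (Suc (m + l)) x - ?U x"
    show "exactly_arrived g n k m x * (\<integral>\<^sup>+y. ?h (x(Service k := y)) \<partial>\<nu> (Service k))
        = exactly_arrived g n k m x * ?e (Suc (m + l)) x"
    proof (cases "?U x < ?T (Suc m) x")
      case True
      have "?T (Suc m) x \<le> ?T (Suc (m + l)) x"
        using pos by (intro sum_mono2) (auto intro: less_imp_le)
      with True have "0 \<le> ?t" by simp
      have "service_start (srv (x(Service k := y))) (Suc k) = ?U x + y" for y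
        by (auto simp: service_start_def intro!: sum.cong)
      then have "?h (x(Service k := y)) = indicator {?t..} y * ennreal (exp (- 0 * (y - ?t)))" for y
        by (auto split: split_indicator)
      then have "(\<integral>\<^sup>+y. ?h (x(Service k := y)) \<partial>\<nu> (Service k)) = ennreal (exp (- mu * ?t))"
        using nn_integral_exponential_tail(1)[of mu 0 ?t] rates \<open>0 \<le> ?t\<close> by (simp add: \<nu>_Service)
      then show ?thesis by simp
    qed (simp add: exactly_arrived_def)
  qed
  also have "\<dots> = (\<integral>\<^sup>+x. (exactly_arrived g n k m x * ?e (Suc m) x)
      * ennreal (exp (- mu * (\<Sum>i=Suc m..<Suc m + l. ia x i))) \<partial>P)"
  proof (rule nn_integral_cong)
    fix x
    have "?T (Suc (m + l)) x = ?T (Suc m) x + (\<Sum>i=Suc m..<Suc m + l. ia x i)"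
      using sum.atLeastLessThan_concat[of 0 "Suc m" "Suc m + l" "ia x"]
      by (simp only: atLeast0LessThan add_Suc)
    then have "?e (Suc (m + l)) x = ?e (Suc m) x * ennreal (exp (- mu * (\<Sum>i=Suc m..<Suc m + l. ia x i)))"
      by (simp only: ennreal_mult'[symmetric] exp_ge_zero exp_add[symmetric]) (simp add: algebra_simps)
    then show "exactly_arrived g n k m x * ?e (Suc (m + l)) x = (exactly_arrived g n k m x * ?e (Suc m) x)
        * ennreal (exp (- mu * (\<Sum>i=Suc m..<Suc m + l. ia x i)))" by (simp only: mult.assoc)
  qed
  also have "\<dots> = ennreal (lam / (lam + mu)) ^ l * (\<integral>\<^sup>+x. exactly_arrived g n k m x * ?e (Suc m) x \<partial>P)"
  proof (rule discount_interarrivals)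
    fix x i y assume i: "Suc m \<le> i"
    then have "?T (Suc m) (x(Interarrival i := y)) = ?T (Suc m) x" by (intro sum.cong) auto
    then show "exactly_arrived g n k m (x(Interarrival i := y)) * ?e (Suc m) (x(Interarrival i := y))
        = exactly_arrived g n k m x * ?e (Suc m) x"
      unfolding exactly_arrived_update(2)[OF i] service_start_update(2) by (simp only:)
  qed (use rates in auto)
  also have "(\<integral>\<^sup>+x. exactly_arrived g n k m x * ?e (Suc m) x \<partial>P)
      = ennreal (lam / (lam + mu)) * (\<integral>\<^sup>+x. exactly_arrived g n k m x \<partial>P)"
    using overshoot[of mu g n k m] overshoot[of 0 g n k m] rates by simp
  finally show ?thesis by (simp add: mult_ac)
qed

lemma AE_sum_exactly_arrived:
  "AE x in P. (\<Sum>m. exactly_arrived g n k m x) = g (tagged_at n x k) \<and>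
     (\<Sum>m. \<Sum>l. exactly_arrived g n k m x
        * of_bool ((\<Sum>i<Suc (m + l). ia x i) \<le> service_start (srv x) (Suc k)))
       = g (tagged_at n x k) * of_nat (joined x k)"
proof (rule eventually_elim2[OF AE_arrival_path AE_srv_pos])
  fix x assume path: "arrival_path (ia x)" and pos: "\<forall>k. 0 < srv x k"
  let ?U = "service_start (srv x)" and ?T = "\<lambda>m. \<Sum>i<m. ia x i"
  let ?h = "\<lambda>l m. of_bool (?T (Suc (m + l)) \<le> ?U (Suc k)) :: ennreal"
  have nonneg: "0 \<le> srv x k" for k using pos less_imp_le by blast
  then have "0 \<le> ?U k" by (simp add: service_start_def sum_nonneg)
  from arrival_path.ex1_count[OF path this]
  obtain m0 where m0: "?T m0 \<le> ?U k" "?U k < ?T (Suc m0)"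
    and uniq: "\<And>m. ?T m \<le> ?U k \<and> ?U k < ?T (Suc m) \<Longrightarrow> m = m0"
    by (elim ex1E) blast
  have "place n (arrivals_among m0 (ia x) (srv x)) (dep x) k = tagged_at n x k"
    by (intro place_cong arrival_path.arrivals_among_eq[OF path nonneg m0(2)]) simp_all
  then have at_m0: "exactly_arrived g n k m0 x = g (tagged_at n x k)"
    using m0 by (simp add: exactly_arrived_def at_least_arrived_def del: sum.lessThan_Suc)
  have ex: "exactly_arrived g n k m x = (if m = m0 then g (tagged_at n x k) else 0)" for m
  proof (cases "m = m0")
    case False
    then have "\<not> (?T m \<le> ?U k \<and> ?U k < ?T (Suc m))" using uniq by blast
    then have "exactly_arrived g n k m x = 0"
      unfolding exactly_arrived_def at_least_arrived_def by (simp only: de_Morgan_conj) auto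
    with False show ?thesis by simp
  qed (simp add: at_m0)
  have "(\<Sum>m. exactly_arrived g n k m x) = g (tagged_at n x k)"
    unfolding ex by (rule sums_unique[symmetric], rule sums_single)
  moreover have "(\<Sum>m. \<Sum>l. exactly_arrived g n k m x * ?h l m) = g (tagged_at n x k) * of_nat (joined x k)"
  proof -
    have "(\<Sum>m. \<Sum>l. exactly_arrived g n k m x * ?h l m)
        = (\<Sum>m. if m = m0 then g (tagged_at n x k) * (\<Sum>l. ?h l m) else 0)"
      unfolding ex by (intro suminf_cong) simp
    also have "\<dots> = g (tagged_at n x k) * (\<Sum>l. ?h l m0)"
      by (rule sums_unique[symmetric], rule sums_single)
    also have "(\<Sum>l. ?h l m0) = ennreal (real (joined x k))"
      unfolding arrivals_during_def by (rule arrival_path.card_arrivals[OF path m0, symmetric])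
    finally show ?thesis by (simp only: ennreal_of_nat_eq_real_of_nat)
  qed
  ultimately show "(\<Sum>m. exactly_arrived g n k m x) = g (tagged_at n x k) \<and>
    (\<Sum>m. \<Sum>l. exactly_arrived g n k m x * ?h l m) = g (tagged_at n x k) * of_nat (joined x k)" ..
qed

text \<open>
  The history enters only through the number of earlier arrivals: on each event that this number is \<open>m\<close>,
  the tail probabilities of \<open>joins_during_service\<close> add up to the same mean \<open>lam / mu\<close>.
\<close>
lemma mean_joined:
  "(\<integral>\<^sup>+x. g (tagged_at n x k) * of_nat (joined x k) \<partial>P)
    = ennreal (lam / mu) * (\<integral>\<^sup>+x. g (tagged_at n x k) \<partial>P)"
proof -
  let ?\<theta> = "lam / (lam + mu)"
  let ?U = "\<lambda>x. service_start (srv x)" and ?T = "\<lambda>m x. \<Sum>i<m. ia x i"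
  let ?h = "\<lambda>l m x. of_bool (?T (Suc (m + l)) x \<le> ?U x (Suc k)) :: ennreal"
  note * = AE_sum_exactly_arrived[of g n k]
  have "(\<Sum>l. ennreal ?\<theta> ^ Suc l) = ennreal (lam / mu)"
  proof -
    have "(\<lambda>l. ?\<theta> * ?\<theta> ^ l) sums (?\<theta> * (1 / (1 - ?\<theta>)))"
      using rates by (intro sums_mult geometric_sums) auto
    also have "?\<theta> * (1 / (1 - ?\<theta>)) = lam / mu"
      using rates by (simp add: divide_simps)
    finally have "(\<lambda>l. ?\<theta> ^ Suc l) sums (lam / mu)" by simp
    then have "(\<lambda>l. ennreal (?\<theta> ^ Suc l)) sums ennreal (lam / mu)"
      using rates by (subst sums_ennreal) auto
    then have "(\<lambda>l. ennreal ?\<theta> ^ Suc l) sums ennreal (lam / mu)"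
      using rates by (simp only: ennreal_power[symmetric] divide_nonneg_pos less_imp_le add_pos_pos)
    then show ?thesis by (rule sums_unique[symmetric])
  qed
  then have "ennreal (lam / mu) * (\<Sum>m. \<integral>\<^sup>+x. exactly_arrived g n k m x \<partial>P)
      = (\<Sum>m. (\<Sum>l. ennreal ?\<theta> ^ Suc l * (\<integral>\<^sup>+x. exactly_arrived g n k m x \<partial>P)))"
    by (simp only: ennreal_suminf_cmult ennreal_suminf_multc)
  also have "\<dots> = (\<Sum>m. (\<Sum>l. \<integral>\<^sup>+x. exactly_arrived g n k m x * ?h l m x \<partial>P))"
    by (simp only: joins_during_service)
  also have "\<dots> = (\<integral>\<^sup>+x. (\<Sum>m. \<Sum>l. exactly_arrived g n k m x * ?h l m x) \<partial>P)"
    by (simp add: nn_integral_suminf del: ennreal_suminf_cmult sum.lessThan_Suc)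
  also have "\<dots> = (\<integral>\<^sup>+x. g (tagged_at n x k) * of_nat (joined x k) \<partial>P)"
    using * by (intro nn_integral_cong_AE) (auto elim!: eventually_mono)
  also have "(\<Sum>m. \<integral>\<^sup>+x. exactly_arrived g n k m x \<partial>P) = (\<integral>\<^sup>+x. (\<Sum>m. exactly_arrived g n k m x) \<partial>P)"
    by (simp add: nn_integral_suminf)
  also have "\<dots> = (\<integral>\<^sup>+x. g (tagged_at n x k) \<partial>P)"
    using * by (intro nn_integral_cong_AE) (auto elim!: eventually_mono)
  finally show ?thesis by simp
qed

section \<open>One service in expectation\<close>

lemma arrivals_during_update:
  "j < k \<Longrightarrow> joined (x(Service k := y)) j = joined x j"
  "joined (x(Departure k := y)) j = joined x j"
  "joined (x(Found := y)) j = joined x j"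
  by (simp_all add: arrivals_during_def service_start_update del: fun_upd_apply)
     (simp_all add: arrival_epoch_def)

lemma tagged_at_update:
  "tagged_at n (x(Service k := y)) k = tagged_at n x k" (is ?service)
  "tagged_at n (x(Departure k := y)) k = tagged_at n x k" (is ?departure)
  "tagged_at n (x(Found := y)) k = tagged_at n x k" (is ?found)
proof -
  show ?service by (rule place_cong) (simp_all only: arrivals_during_update, simp_all)
  show ?departure by (rule place_cong) (simp_all only: arrivals_during_update, simp_all)
  show ?found by (rule place_cong) (simp_all only: arrivals_during_update, simp_all)
qed

lemma nn_integral_departure:
  "(\<integral>\<^sup>+y. (if y = 1 then u else v) \<partial>\<nu> (Departure k)) = ennreal q * u + ennreal (1 - q) * v"
proof -
  have [simp]: "space (\<nu> (Departure k)) = UNIV" using sets_eq_imp_space_eq[OF sets_\<nu>] by simp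
  have [measurable]: "{1} \<in> sets (\<nu> (Departure k))" "- {1} \<in> sets (\<nu> (Departure k))"
    by (simp_all add: sets_\<nu>)
  have "emeasure (\<nu> (Departure k)) (- {1}) = 1 - ennreal q"
    using emeasure_compl[of "{1}" "\<nu> (Departure k)"] prob_space.emeasure_space_1[OF prob_space_\<nu>, of "Departure k"]
    by (simp add: Compl_eq_Diff_UNIV \<nu>_Departure)
  then have c: "emeasure (\<nu> (Departure k)) (- {1}) = ennreal (1 - q)"
    using q by (simp add: ennreal_minus flip: ennreal_1)
  have "(\<integral>\<^sup>+y. (if y = 1 then u else v) \<partial>\<nu> (Departure k))
      = (\<integral>\<^sup>+y. u * indicator {1} y + v * indicator (- {1}) y \<partial>\<nu> (Departure k))"
    by (intro nn_integral_cong) (auto split: split_indicator)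
  also have "\<dots> = u * ennreal q + v * ennreal (1 - q)"
    by (subst nn_integral_add) (simp_all add: nn_integral_cmult_indicator c \<nu>_Departure)
  finally show ?thesis by (simp add: mult.commute)
qed

text \<open>
  The departure decision is resampled and the number of arrivals is replaced by its mean, which is
  possible because the averaged value of \<open>g\<close> is affine in that number.
\<close>
lemma one_step:
  assumes "\<And>\<sigma> c. ennreal q * g (service_step \<sigma> c True) + ennreal (1 - q) * g (service_step \<sigma> c False) = f \<sigma> + e \<sigma> * of_nat c"
  shows "(\<integral>\<^sup>+x. g (tagged_at n x (Suc k)) \<partial>P)
    = (\<integral>\<^sup>+x. f (tagged_at n x k) + ennreal (lam / mu) * e (tagged_at n x k) \<partial>P)"
proof -
  have "(\<integral>\<^sup>+x. g (tagged_at n x (Suc k)) \<partial>P)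
      = (\<integral>\<^sup>+x. \<integral>\<^sup>+y. g (tagged_at n (x(Departure k := y)) (Suc k)) \<partial>\<nu> (Departure k) \<partial>P)"
    by (rule resample) (rule measurable_tagged_at)
  also have "\<dots> = (\<integral>\<^sup>+x. f (tagged_at n x k) + e (tagged_at n x k) * of_nat (joined x k) \<partial>P)"
  proof (rule nn_integral_cong)
    fix x
    have "g (tagged_at n (x(Departure k := y)) (Suc k))
        = (if y = 1 then g (service_step (tagged_at n x k) (joined x k) True)
           else g (service_step (tagged_at n x k) (joined x k) False))" for y
      unfolding place.simps tagged_at_update arrivals_during_update by simp
    then show "(\<integral>\<^sup>+y. g (tagged_at n (x(Departure k := y)) (Suc k)) \<partial>\<nu> (Departure k))
        = f (tagged_at n x k) + e (tagged_at n x k) * of_nat (joined x k)"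
      by (simp only: nn_integral_departure assms)
  qed
  also have "\<dots> = (\<integral>\<^sup>+x. f (tagged_at n x k) \<partial>P) + (\<integral>\<^sup>+x. e (tagged_at n x k) * of_nat (joined x k) \<partial>P)"
    by (rule nn_integral_add) measurable
  also have "\<dots> = (\<integral>\<^sup>+x. f (tagged_at n x k) + ennreal (lam / mu) * e (tagged_at n x k) \<partial>P)"
    unfolding mean_joined by (simp add: nn_integral_add nn_integral_cmult)
  finally show ?thesis .
qed

definition expected_next :: "real \<Rightarrow> real \<Rightarrow> real \<Rightarrow> (nat \<times> nat) option \<Rightarrow> ennreal" where
  "expected_next \<alpha> \<beta> \<gamma> \<sigma> = (case \<sigma> of
       None \<Rightarrow> 0
     | Some (j, b) \<Rightarrow>
         if 0 < j then ennreal (\<alpha> * (real j - 1) + \<beta> * (real b + lam / mu + (1 - q)) + \<gamma>)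
         else ennreal ((1 - q) * (\<alpha> * (real b + lam / mu) + \<gamma>)))"

lemma one_step_linear:
  assumes "0 \<le> \<alpha>" "0 \<le> \<beta>" "0 \<le> \<gamma>"
  shows "(\<integral>\<^sup>+x. linear_cost \<alpha> \<beta> \<gamma> (tagged_at n x (Suc k)) \<partial>P)
    = (\<integral>\<^sup>+x. expected_next \<alpha> \<beta> \<gamma> (tagged_at n x k) \<partial>P)"
proof -
  define f where "f \<sigma> = (case \<sigma> of
      None \<Rightarrow> 0
    | Some (j, b) \<Rightarrow>
        if 0 < j then ennreal (\<alpha> * (real j - 1) + \<beta> * (real b + (1 - q)) + \<gamma>)
        else ennreal ((1 - q) * (\<alpha> * real b + \<gamma>)))" for \<sigma> :: "(nat \<times> nat) option"
  define e where "e \<sigma> = (case \<sigma> of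
      None \<Rightarrow> 0
    | Some (j, b) \<Rightarrow> if 0 < j then ennreal \<beta> else ennreal ((1 - q) * \<alpha>))" for \<sigma> :: "(nat \<times> nat) option"
  have "ennreal q * linear_cost \<alpha> \<beta> \<gamma> (service_step \<sigma> c True)
      + ennreal (1 - q) * linear_cost \<alpha> \<beta> \<gamma> (service_step \<sigma> c False) = f \<sigma> + e \<sigma> * of_nat c" for \<sigma> c
  proof (cases \<sigma>)
    case (Some jb)
    obtain j b where jb: "jb = (j, b)" by fastforce
    show ?thesis
    proof (cases j)
      case 0
      have "(1 - q) * (\<alpha> * (real b + real c) + \<gamma>) = (1 - q) * (\<alpha> * real b + \<gamma>) + (1 - q) * \<alpha> * real c"
        by (simp add: algebra_simps)
      then show ?thesis using Some jb assms q 0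
        by (simp add: f_def e_def linear_cost_def service_step_def ennreal_of_nat_eq_real_of_nat
            ennreal_mult'[symmetric] ennreal_plus[symmetric] del: ennreal_plus)
    next
      case (Suc j')
      have "q * (\<alpha> * real j' + \<beta> * (real b + real c) + \<gamma>)
          + (1 - q) * (\<alpha> * real j' + \<beta> * (1 + (real b + real c)) + \<gamma>)
          = (\<alpha> * real j' + \<beta> * (real b + (1 - q)) + \<gamma>) + \<beta> * real c"
        by (simp add: algebra_simps)
      then show ?thesis using Some jb assms q Suc
        by (simp add: f_def e_def linear_cost_def service_step_def ennreal_of_nat_eq_real_of_nat
            ennreal_mult'[symmetric] ennreal_plus[symmetric] del: ennreal_plus)
    qed
  qed (simp add: f_def e_def linear_cost_def)
  from one_step[of "linear_cost \<alpha> \<beta> \<gamma>" f e, OF this]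
  have "(\<integral>\<^sup>+x. linear_cost \<alpha> \<beta> \<gamma> (tagged_at n x (Suc k)) \<partial>P)
    = (\<integral>\<^sup>+x. f (tagged_at n x k) + ennreal (lam / mu) * e (tagged_at n x k) \<partial>P)" .
  also have "\<dots> = (\<integral>\<^sup>+x. expected_next \<alpha> \<beta> \<gamma> (tagged_at n x k) \<partial>P)"
  proof (rule nn_integral_cong)
    fix x
    have "f \<sigma> + ennreal (lam / mu) * e \<sigma> = expected_next \<alpha> \<beta> \<gamma> \<sigma>" for \<sigma>
    proof (cases \<sigma>)
      case (Some jb)
      obtain j b where jb: "jb = (j, b)" by fastforce
      show ?thesis
      proof (cases j)
        case 0
        have "(1 - q) * (\<alpha> * real b + \<gamma>) + lam / mu * ((1 - q) * \<alpha>)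
            = (1 - q) * (\<alpha> * (real b + lam / mu) + \<gamma>)"
          by (simp add: distrib_left mult_ac)
        then show ?thesis using Some jb 0 assms q rates
          by (simp add: f_def e_def expected_next_def ennreal_mult'[symmetric] ennreal_plus[symmetric]
              del: ennreal_plus times_divide_eq_left)
      next
        case (Suc j')
        have "(\<alpha> * real j' + \<beta> * (real b + (1 - q)) + \<gamma>) + lam / mu * \<beta>
            = \<alpha> * real j' + \<beta> * (real b + lam / mu + (1 - q)) + \<gamma>"
          by (simp add: distrib_left mult_ac)
        then show ?thesis using Some jb Suc assms q rates
          by (simp add: f_def e_def expected_next_def ennreal_mult'[symmetric] ennreal_plus[symmetric]
              del: ennreal_plus times_divide_eq_left)
      qed
    qed (simp add: f_def e_def expected_next_def)
    then show "f (tagged_at n x k) + ennreal (lam / mu) * e (tagged_at n x k)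
      = expected_next \<alpha> \<beta> \<gamma> (tagged_at n x k)" .
  qed
  finally show ?thesis .
qed

end

section \<open>The expected time in the system\<close>

text \<open>
  The inequality says that the denominator in the answer is positive. Stability, \<open>lam < q * mu\<close>,
  implies it, as \<open>1 - q < 1 < 2 - q\<close>.
\<close>
locale stable_feedback_primitives = feedback_primitives +
  assumes stable: "(1 - q) * lam < (2 - q) * q * mu"
begin

text \<open>The expected delay caused by one customer ahead of her.\<close>
definition weight :: real where
  "weight = 1 / ((q - 1) * lam - (q - 2) * q * mu)"

lemma weight_pos: "0 < weight"
  using stable by (simp add: weight_def algebra_simps)

lemma weight_eq: "weight * mu = 1 + weight * (1 - q) * (lam + (1 - q) * mu)"
proof -
  have "(q - 1) * lam - (q - 2) * q * mu \<noteq> 0" using stable by (simp add: algebra_simps)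
  then show ?thesis by (simp add: weight_def field_simps)
qed

abbreviation remaining :: "(nat \<times> nat) option \<Rightarrow> ennreal" where
  "remaining \<equiv> linear_cost weight ((1 - q) * weight) ((2 - q) * weight)"

text \<open>
  For \<open>j > 0\<close> the drop is the relation \<open>weight_eq\<close>. For \<open>j = 0\<close> the coefficients of \<open>b\<close> agree because
  with probability \<open>1 - q\<close> those behind become those ahead, and \<open>2 - q\<close> is the factor that
  makes the constant terms differ by \<open>1 / mu\<close>.
\<close>
lemma remaining_step:
  "(\<integral>\<^sup>+x. remaining (tagged_at n x (Suc k)) \<partial>P)
     + ennreal (1 / mu) * (\<integral>\<^sup>+x. present (tagged_at n x k) \<partial>P)
   = (\<integral>\<^sup>+x. remaining (tagged_at n x k) \<partial>P)"
proof -
  have "expected_next weight ((1 - q) * weight) ((2 - q) * weight) \<sigma> + ennreal (1 / mu) * present \<sigma>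
      = remaining \<sigma>" for \<sigma>
  proof (cases \<sigma>)
    case (Some jb)
    obtain j b where jb: "jb = (j, b)" by fastforce
    define r where "r = lam / mu"
    have "0 \<le> r" using rates by (simp add: r_def)
    have w: "1 / mu = weight - weight * (1 - q) * (r + (1 - q))"
      using weight_eq rates by (simp add: r_def field_simps)
    show ?thesis
    proof (cases j)
      case 0
      have "(1 - q) * (weight * (real b + r) + (2 - q) * weight) + 1 / mu
          = (1 - q) * weight * real b + (2 - q) * weight"
        unfolding w by (simp add: algebra_simps)
      then show ?thesis using Some jb 0 weight_pos q rates \<open>0 \<le> r\<close>
        by (simp add: r_def[symmetric] expected_next_def present_def linear_cost_def ennreal_plus[symmetric] del: ennreal_plus)
    next
      case (Suc j')
      have "weight * real j' + (1 - q) * weight * (real b + r + (1 - q)) + (2 - q) * weight + 1 / mu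
          = weight * (1 + real j') + (1 - q) * weight * real b + (2 - q) * weight"
        unfolding w by (simp add: algebra_simps)
      then show ?thesis using Some jb Suc weight_pos q rates \<open>0 \<le> r\<close>
        by (simp add: r_def[symmetric] expected_next_def present_def linear_cost_def ennreal_plus[symmetric] del: ennreal_plus)
    qed
  qed (simp add: expected_next_def present_def linear_cost_def)
  then show ?thesis
    using one_step_linear[of weight "(1 - q) * weight" "(2 - q) * weight" n k] weight_pos q
    by (simp add: nn_integral_add[symmetric] nn_integral_cmult[symmetric] del: place.simps)
qed

text \<open>
  Apart from new arrivals, those present at her own service stop counting with probability \<open>q\<close>, namely
  if she departs; this pays for the term with \<open>behind_head\<close>. Arrivals and rejoining customers are
  covered by the constant on the right.
\<close>
lemma crowd_step:
  "(\<integral>\<^sup>+x. linear_cost 1 1 0 (tagged_at n x (Suc k)) \<partial>P)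
     + ennreal q * (\<integral>\<^sup>+x. behind_head (tagged_at n x k) \<partial>P)
   \<le> (\<integral>\<^sup>+x. linear_cost 1 1 0 (tagged_at n x k) \<partial>P)
     + ennreal (lam / mu + 1) * (\<integral>\<^sup>+x. present (tagged_at n x k) \<partial>P)"
proof -
  have "expected_next 1 1 0 \<sigma> + ennreal q * behind_head \<sigma>
      \<le> linear_cost 1 1 0 \<sigma> + ennreal (lam / mu + 1) * present \<sigma>" for \<sigma>
  proof (cases \<sigma>)
    case (Some jb)
    obtain j b where jb: "jb = (j, b)" by fastforce
    show ?thesis
    proof (cases j)
      case 0
      have "(1 - q) * (real b + lam / mu) + q * real b \<le> real b + (lam / mu + 1)"
        using q rates mult_right_mono[of "1 - q" 1 "lam / mu"] by (simp add: algebra_simps)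
      then show ?thesis using Some jb 0 q rates
        by (simp add: expected_next_def present_def behind_head_def linear_cost_def
            ennreal_of_nat_eq_real_of_nat ennreal_mult'[symmetric] ennreal_plus[symmetric] ennreal_leI
            del: ennreal_plus)
    next
      case (Suc j')
      then show ?thesis using Some jb q rates
        by (simp add: expected_next_def present_def behind_head_def linear_cost_def
            ennreal_plus[symmetric] ennreal_leI del: ennreal_plus)
    qed
  qed (simp add: expected_next_def behind_head_def)
  then have "(\<integral>\<^sup>+x. expected_next 1 1 0 (tagged_at n x k) + ennreal q * behind_head (tagged_at n x k) \<partial>P)
    \<le> (\<integral>\<^sup>+x. linear_cost 1 1 0 (tagged_at n x k) + ennreal (lam / mu + 1) * present (tagged_at n x k) \<partial>P)"
    by (intro nn_integral_mono)
  then show ?thesis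
    using one_step_linear[of 1 1 0 n k]
    by (simp add: nn_integral_add nn_integral_cmult del: place.simps)
qed

lemma sum_present:
  "(\<integral>\<^sup>+x. remaining (tagged_at n x k) \<partial>P)
     + ennreal (1 / mu) * (\<Sum>l<k. \<integral>\<^sup>+x. present (tagged_at n x l) \<partial>P) = remaining (Some (n, 0))"
proof (induction k)
  case 0
  show ?case using P.emeasure_space_1 by simp
next
  case (Suc k)
  let ?p = "\<lambda>l. \<integral>\<^sup>+x. present (tagged_at n x l) \<partial>P"
    and ?H = "\<lambda>l. \<integral>\<^sup>+x. remaining (tagged_at n x l) \<partial>P"
  have "?H (Suc k) + ennreal (1 / mu) * (\<Sum>l<Suc k. ?p l)
      = (?H (Suc k) + ennreal (1 / mu) * ?p k) + ennreal (1 / mu) * (\<Sum>l<k. ?p l)"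
    by (simp only: sum.lessThan_Suc distrib_left ac_simps)
  also have "\<dots> = remaining (Some (n, 0))" by (simp only: remaining_step Suc)
  finally show ?case .
qed

lemma suminf_present_finite: "(\<Sum>k. \<integral>\<^sup>+x. present (tagged_at n x k) \<partial>P) < \<top>"
proof -
  have "ennreal (1 / mu) * (\<Sum>k. \<integral>\<^sup>+x. present (tagged_at n x k) \<partial>P) \<le> remaining (Some (n, 0))"
    unfolding ennreal_suminf_cmult[symmetric]
  proof (rule suminf_le_const)
    fix k
    show "(\<Sum>l<k. ennreal (1 / mu) * (\<integral>\<^sup>+x. present (tagged_at n x l) \<partial>P)) \<le> remaining (Some (n, 0))"
      unfolding sum_distrib_left[symmetric] sum_present[of n k, symmetric] by simp
  qed simp
  also have "\<dots> < \<top>" by (simp add: linear_cost_def)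
  finally show ?thesis using rates by (auto simp: ennreal_mult_less_top)
qed

lemma suminf_behind_head_finite: "(\<Sum>k. \<integral>\<^sup>+x. behind_head (tagged_at n x k) \<partial>P) < \<top>"
proof -
  let ?p = "\<lambda>k. \<integral>\<^sup>+x. present (tagged_at n x k) \<partial>P"
    and ?y = "\<lambda>k. \<integral>\<^sup>+x. behind_head (tagged_at n x k) \<partial>P"
  have *: "(\<integral>\<^sup>+x. linear_cost 1 1 0 (tagged_at n x k) \<partial>P) + ennreal q * (\<Sum>l<k. ?y l)
      \<le> of_nat n + ennreal (lam / mu + 1) * (\<Sum>l<k. ?p l)" for k
  proof (induction k)
    case 0
    show ?case using P.emeasure_space_1 by (simp add: linear_cost_def ennreal_of_nat_eq_real_of_nat)
  next
    case (Suc k)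
    let ?L = "\<lambda>k. \<integral>\<^sup>+x. linear_cost 1 1 0 (tagged_at n x k) \<partial>P"
    have "?L (Suc k) + ennreal q * (\<Sum>l<Suc k. ?y l)
        = (?L (Suc k) + ennreal q * ?y k) + ennreal q * (\<Sum>l<k. ?y l)"
      by (simp add: distrib_left ac_simps del: place.simps)
    also have "\<dots> \<le> (?L k + ennreal (lam / mu + 1) * ?p k) + ennreal q * (\<Sum>l<k. ?y l)"
      by (rule add_right_mono) (rule crowd_step)
    also have "\<dots> = (?L k + ennreal q * (\<Sum>l<k. ?y l)) + ennreal (lam / mu + 1) * ?p k"
      by (simp only: ac_simps)
    also have "\<dots> \<le> (of_nat n + ennreal (lam / mu + 1) * (\<Sum>l<k. ?p l)) + ennreal (lam / mu + 1) * ?p k"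
      by (rule add_right_mono) (rule Suc)
    also have "\<dots> = of_nat n + ennreal (lam / mu + 1) * (\<Sum>l<Suc k. ?p l)"
      by (simp only: sum.lessThan_Suc distrib_left add.assoc)
    finally show ?case .
  qed
  have "ennreal q * (\<Sum>k. ?y k) \<le> of_nat n + ennreal (lam / mu + 1) * (\<Sum>k. ?p k)"
    unfolding ennreal_suminf_cmult[symmetric]
  proof (rule suminf_le_const)
    fix k
    have "(\<Sum>l<k. ennreal q * ?y l) \<le> of_nat n + ennreal (lam / mu + 1) * (\<Sum>l<k. ?p l)"
      using *[of k] by (auto simp: sum_distrib_left intro: order_trans[OF add_increasing, rotated -1])
    also have "\<dots> \<le> of_nat n + ennreal (lam / mu + 1) * (\<Sum>l. ?p l)"
      by (intro add_left_mono mult_left_mono sum_le_suminf) auto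
    finally show "(\<Sum>l<k. ennreal q * ?y l) \<le> of_nat n + (\<Sum>l. ennreal (lam / mu + 1) * ?p l)"
      by (simp only: ennreal_suminf_cmult)
  qed simp
  also have "\<dots> < \<top>"
    using suminf_present_finite[of n] by (simp add: ennreal_mult_less_top of_nat_less_top)
  finally show ?thesis using q by (auto simp: ennreal_mult_less_top)
qed

lemma remaining_tendsto_0: "(\<lambda>k. \<integral>\<^sup>+x. remaining (tagged_at n x k) \<partial>P) \<longlonglongrightarrow> 0"
proof -
  let ?c = "\<lambda>k. (\<integral>\<^sup>+x. present (tagged_at n x k) \<partial>P) + (\<integral>\<^sup>+x. behind_head (tagged_at n x k) \<partial>P)"
  let ?\<gamma> = "ennreal ((2 - q) * weight)"
  have "(\<Sum>k. ?c k) = (\<Sum>k. \<integral>\<^sup>+x. present (tagged_at n x k) \<partial>P)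
      + (\<Sum>k. \<integral>\<^sup>+x. behind_head (tagged_at n x k) \<partial>P)"
    by (rule suminf_add[symmetric]) simp_all
  also have "\<dots> < \<top>" using suminf_present_finite suminf_behind_head_finite by simp
  finally have "(\<Sum>k. ?c k) \<noteq> \<top>" by simp
  from ennreal_tendsto_cmult[OF _ ennreal_suminf_tail[OF this], of ?\<gamma>]
  have lim: "(\<lambda>k. ?\<gamma> * (\<Sum>l. ?c (l + k))) \<longlonglongrightarrow> 0" by simp
  have bound: "(\<integral>\<^sup>+x. remaining (tagged_at n x k) \<partial>P) \<le> ?\<gamma> * (\<Sum>l. ?c (l + k))" for k
  proof -
    have "(\<integral>\<^sup>+x. remaining (tagged_at n x k) \<partial>P)
        \<le> (\<integral>\<^sup>+x. ?\<gamma> * (\<Sum>l. present (tagged_at n x (l + k)) + behind_head (tagged_at n x (l + k))) \<partial>P)"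
      using weight_pos q by (intro nn_integral_mono linear_cost_le_future) auto
    also have "\<dots> = ?\<gamma> * (\<Sum>l. ?c (l + k))"
      by (simp add: nn_integral_cmult nn_integral_suminf nn_integral_add del: ennreal_suminf_cmult)
    finally show ?thesis .
  qed
  show ?thesis
    by (rule tendsto_sandwich[OF _ _ tendsto_const lim]; rule always_eventually, rule allI)
       (rule zero_le bound)+
qed

lemma suminf_present:
  "ennreal (1 / mu) * (\<Sum>k. \<integral>\<^sup>+x. present (tagged_at n x k) \<partial>P) = remaining (Some (n, 0))"
proof -
  let ?p = "\<lambda>k. \<integral>\<^sup>+x. present (tagged_at n x k) \<partial>P"
  have "(\<lambda>k. \<Sum>l<k. ?p l) \<longlonglongrightarrow> (\<Sum>l. ?p l)" by (rule summable_LIMSEQ) simp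
  then have "(\<lambda>k. (\<integral>\<^sup>+x. remaining (tagged_at n x k) \<partial>P) + ennreal (1 / mu) * (\<Sum>l<k. ?p l))
      \<longlonglongrightarrow> 0 + ennreal (1 / mu) * (\<Sum>l. ?p l)"
    by (intro tendsto_add remaining_tendsto_0 ennreal_tendsto_cmult) auto
  then show ?thesis unfolding sum_present by (simp add: LIMSEQ_const_iff)
qed

definition total_service :: "nat \<Rightarrow> (primitive \<Rightarrow> real) \<Rightarrow> ennreal" where
  "total_service n x = (\<Sum>k. ennreal (srv x k) * present (tagged_at n x k))"

lemma measurable_total_service [measurable]: "total_service n \<in> borel_measurable P"
  unfolding total_service_def[abs_def] by measurable

text \<open>
  Wald's identity: whether she is present at the start of a service depends only on earlier services, so
  the duration of this one may be resampled.
\<close>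
lemma nn_integral_total_service:
  "(\<integral>\<^sup>+x. total_service n x \<partial>P) = ennreal ((real n + 2 - q) * weight)"
proof -
  have "(\<integral>\<^sup>+x. ennreal (srv x k) * present (tagged_at n x k) \<partial>P)
      = ennreal (1 / mu) * (\<integral>\<^sup>+x. present (tagged_at n x k) \<partial>P)" for k
  proof -
    have "(\<integral>\<^sup>+x. present (tagged_at n x k) * ennreal (srv x k) \<partial>P)
        = (\<integral>\<^sup>+x. present (tagged_at n x k) * (\<integral>\<^sup>+y. ennreal (srv (x(Service k := y)) k) \<partial>\<nu> (Service k)) \<partial>P)"
      by (rule resample_factor) (measurable, simp only: tagged_at_update)
    also have "\<dots> = (\<integral>\<^sup>+x. present (tagged_at n x k) * ennreal (1 / mu) \<partial>P)"
      using nn_integral_exponential_mean[OF rates(2)] by (simp add: \<nu>_Service)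
    finally show ?thesis by (simp add: nn_integral_cmult[symmetric] mult.commute)
  qed
  then have "(\<integral>\<^sup>+x. total_service n x \<partial>P) = ennreal (1 / mu) * (\<Sum>k. \<integral>\<^sup>+x. present (tagged_at n x k) \<partial>P)"
    by (simp add: total_service_def nn_integral_suminf)
  then show ?thesis by (simp only: suminf_present) (simp add: linear_cost_def algebra_simps)
qed

lemma AE_sojourn_time:
  "AE x in P. sojourn_time n (ia x) (srv x) (dep x) = total_service n x"
proof -
  have "(\<integral>\<^sup>+x. (\<Sum>k. present (tagged_at n x k)) \<partial>P) \<noteq> \<infinity>"
    using suminf_present_finite[of n] by (simp add: nn_integral_suminf)
  then have "AE x in P. (\<Sum>k. present (tagged_at n x k)) \<noteq> \<infinity>"
    by (intro nn_integral_noteq_infinite) simp_all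
  then show ?thesis
  proof (rule eventually_elim2[OF _ AE_srv_pos])
    fix x assume fin: "(\<Sum>k. present (tagged_at n x k)) \<noteq> \<infinity>" and pos: "\<forall>k. 0 < srv x k"
    have "\<exists>k. tagged_at n x k = None"
    proof (rule ccontr)
      assume "\<not> ?thesis"
      then have *: "present (tagged_at n x k) = 1" for k by (simp add: present_def)
      obtain r where r: "0 \<le> r" "(\<Sum>k. present (tagged_at n x k)) = ennreal r"
        using fin by (cases "\<Sum>k. present (tagged_at n x k)") auto
      obtain m :: nat where "r < real m" using reals_Archimedean2 by blast
      moreover have "of_nat m \<le> (\<Sum>k. present (tagged_at n x k))"
        using sum_le_suminf[of "\<lambda>k. present (tagged_at n x k)" "{..<m}"] by (simp add: *)
      ultimately show False
        unfolding r(2) ennreal_of_nat_eq_real_of_nat using r(1) by simp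
    qed
    then obtain K where "tagged_at n x K = None" ..
    then show "sojourn_time n (ia x) (srv x) (dep x) = total_service n x"
      unfolding total_service_def present_def using pos
      by (intro sojourn_time_eq_suminf) (auto intro: less_imp_le)
  qed
qed

lemma nn_integral_total_service_found:
  "(\<integral>\<^sup>+x. total_service n x * indicator {x. x Found = u} x \<partial>P)
    = ennreal ((real n + 2 - q) * weight) * emeasure P {x. x Found = u}"
proof -
  have found: "(\<integral>\<^sup>+x. g x * indicator {x. x Found = u} x \<partial>P)
      = (\<integral>\<^sup>+x. g x \<partial>P) * emeasure (\<nu> Found) {u}"
    if [measurable]: "g \<in> borel_measurable P" and g: "\<And>x y. g (x(Found := y)) = g x" for g
  proof -
    have [measurable]: "{x. x Found = u} \<in> sets P"
    proof -
      have "{x \<in> space P. x Found = u} \<in> sets P" by measurable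
      then show ?thesis by simp
    qed
    have "(\<integral>\<^sup>+x. g x * indicator {x. x Found = u} x \<partial>P)
        = (\<integral>\<^sup>+x. g x * (\<integral>\<^sup>+y. indicator {x. x Found = u} (x(Found := y)) \<partial>\<nu> Found) \<partial>P)"
      by (rule resample_factor) (measurable, rule g)
    also have "\<dots> = (\<integral>\<^sup>+x. g x * (\<integral>\<^sup>+y. indicator {u} y \<partial>\<nu> Found) \<partial>P)"
      by (intro nn_integral_cong arg_cong2[of _ _ _ _ "(*)"] refl) (auto split: split_indicator)
    also have "\<dots> = (\<integral>\<^sup>+x. g x \<partial>P) * emeasure (\<nu> Found) {u}"
      by (simp add: nn_integral_multc sets_\<nu>)
    finally show ?thesis .
  qed
  have "total_service n (x(Found := y)) = total_service n x" for x y
    unfolding total_service_def tagged_at_update by simp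
  moreover have "emeasure P {x. x Found = u} = emeasure (\<nu> Found) {u}"
  proof -
    have "{x \<in> space P. x Found = u} \<in> sets P" by measurable
    then show ?thesis using found[of "\<lambda>_. 1"] P.emeasure_space_1 by simp
  qed
  ultimately show ?thesis using found[of "total_service n"] by (simp add: nn_integral_total_service)
qed

end

section \<open>Conditioning on the position\<close>

text \<open>
  Global balance of a birth-death chain implies detailed balance, so all probabilities vanish if one does.
  Positivity is what makes the conditioning event non-null.
\<close>
lemma stationary_pmf_pos:
  assumes st: "stationary_queue_length lam mu q p" and rates: "0 < lam" "0 < q * mu"
  shows "0 < pmf p n"
proof -
  have balance: "pmf p n * (\<Sum>m\<le>Suc n. queue_rate lam mu q n m)
      = (\<Sum>m\<le>Suc n. pmf p m * queue_rate lam mu q m n)" for n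
    using st by (simp add: stationary_queue_length_def)
  have detailed: "pmf p (Suc n) * (q * mu) = pmf p n * lam" for n
  proof (induction n)
    case 0
    show ?case using balance[of 0] by (simp add: queue_rate_def)
  next
    case (Suc k)
    have split: "(\<Sum>m\<le>Suc (Suc k). f m) = (\<Sum>m<k. f m) + f k + f (Suc k) + f (Suc (Suc k))"
      for f :: "nat \<Rightarrow> real" by (simp flip: lessThan_Suc_atMost)
    have "(\<Sum>m<k. queue_rate lam mu q (Suc k) m) = 0" "(\<Sum>m<k. pmf p m * queue_rate lam mu q m (Suc k)) = 0"
      by (auto intro!: sum.neutral simp: queue_rate_def)
    then have "pmf p (Suc k) * (q * mu + lam) = pmf p k * lam + pmf p (Suc (Suc k)) * (q * mu)"
      using balance[of "Suc k"] unfolding split by (simp add: queue_rate_def)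
    with Suc show ?case by (simp add: algebra_simps)
  qed
  have "pmf p 0 \<noteq> 0"
  proof
    assume z: "pmf p 0 = 0"
    have "pmf p m = 0" for m
      using detailed rates by (induction m) (auto simp: z, metis mult_eq_0_iff order_less_irrefl)
    then show False using set_pmf_not_empty[of p] by (simp add: set_pmf_eq)
  qed
  then have "pmf p n \<noteq> 0"
    by (induction n) (use detailed rates in \<open>auto, metis mult_eq_0_iff order_less_irrefl\<close>)
  then show ?thesis using pmf_nonneg[of p n] by simp
qed

theorem mainTheorem7:
  fixes M :: "'a measure" and lam mu q :: real
    and N :: "'a \<Rightarrow> nat" and A S :: "nat \<Rightarrow> 'a \<Rightarrow> real" and D :: "nat \<Rightarrow> 'a \<Rightarrow> bool"
    and i :: nat
  assumes "0 < lam" and "0 < mu" and "0 < q" and "q < 1"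
    and "lam < q * mu"
    and "stationary_feedback_queue M lam mu q N A S D"
    and "1 \<le> i"
  shows "cond_expectation_event M (sojourn N A S D) {\<omega> \<in> space M. joining_position N \<omega> = i} =
    ennreal ((real i + 1 - q) / ((q - 1) * lam - (q - 2) * q * mu))"
proof -
  interpret stationary_feedback_queue M lam mu q N A S D by fact
  note emeasure_M = emeasure_eq_measure
  define X :: "primitive \<Rightarrow> 'a \<Rightarrow> real" where "X p \<omega> = (case p of
      Found \<Rightarrow> real (N \<omega>) | Interarrival m \<Rightarrow> A m \<omega> | Service k \<Rightarrow> S k \<omega>
    | Departure k \<Rightarrow> of_bool (D k \<omega>))" for p \<omega>
  have indep_X: "indep_vars (\<lambda>_. borel) X UNIV"
    using indep unfolding X_def[abs_def] by (simp add: fun_eq_iff)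
  then have X [measurable]: "X p \<in> borel_measurable M" for p by (auto simp: indep_vars_def)
  define \<nu> where "\<nu> p = distr M borel (X p)" for p
  define Y where "Y \<omega> = (\<lambda>p. X p \<omega>)" for \<omega>
  have Y [measurable]: "Y \<in> M \<rightarrow>\<^sub>M PiM UNIV (\<lambda>_. borel)"
    unfolding Y_def[abs_def] by (rule measurable_PiM_single') (auto simp: X)
  have law: "distr M (PiM UNIV (\<lambda>_. borel)) Y = PiM UNIV \<nu>"
    using indep_vars_iff_distr_eq_PiM[where I = UNIV and M' = "\<lambda>_. borel" and X = X] indep_X X
    by (simp add: \<nu>_def[abs_def] Y_def[abs_def] restrict_UNIV)
  have \<nu>_exponential: "\<nu> p = density lborel (exponential_density l)"
    if "distributed M lborel (X p) (exponential_density l)" for p l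
    using distributed_distr_eq_density[OF that] by (simp add: \<nu>_def cong: distr_cong)
  \<comment> \<open>Independence makes the joint law of all primitives the product of their laws, so that the results
    about the product space apply to it.\<close>
  interpret stable_feedback_primitives lam mu q \<nu>
  proof (intro stable_feedback_primitives.intro feedback_primitives.intro
      stable_feedback_primitives_axioms.intro)
    show "prob_space (\<nu> p)" for p unfolding \<nu>_def by (rule prob_space_distr) (rule X)
    show "\<nu> (Interarrival m) = density lborel (exponential_density lam)" for m
      using interarrival by (intro \<nu>_exponential) (simp add: X_def[abs_def])
    show "\<nu> (Service k) = density lborel (exponential_density mu)" for k
      using service by (intro \<nu>_exponential) (simp add: X_def[abs_def])
    show "emeasure (\<nu> (Departure k)) {1} = ennreal q" for k
    proof -
      have "emeasure (\<nu> (Departure k)) {1} = emeasure M (X (Departure k) -` {1} \<inter> space M)"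
        unfolding \<nu>_def by (rule emeasure_distr) (simp_all add: X)
      also have "X (Departure k) -` {1} \<inter> space M = {\<omega> \<in> space M. D k \<omega>}" by (auto simp: X_def)
      finally show ?thesis by (simp add: emeasure_eq_measure departure)
    qed
    have "(1 - q) * lam \<le> 1 * lam" using assms by (intro mult_right_mono) auto
    also have "\<dots> < q * mu" using assms by simp
    also have "\<dots> \<le> (2 - q) * (q * mu)"
      using assms mult_right_mono[of 1 "2 - q" "q * mu"] by simp
    finally show "(1 - q) * lam < (2 - q) * q * mu" by (simp add: mult.assoc)
  qed (use assms in \<open>simp_all add: \<nu>_def\<close>)

  obtain n where i: "i = Suc n" using \<open>1 \<le> i\<close> by (cases i) auto
  let ?E = "{\<omega> \<in> space M. joining_position N \<omega> = i}"
  have E_eq: "?E = {\<omega> \<in> space M. N \<omega> = n}" by (auto simp: joining_position_def i)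
  have E_Y: "\<omega> \<in> ?E \<longleftrightarrow> Y \<omega> \<in> {x. x Found = real n}" if "\<omega> \<in> space M" for \<omega>
    using that by (auto simp: E_eq Y_def X_def)
  have "{x \<in> space P. x Found = real n} \<in> sets P" by measurable
  then have found: "{x. x Found = real n} \<in> sets P" by simp
  have sets_P: "sets P = sets (PiM UNIV (\<lambda>_. borel))"
    by (rule sets_PiM_cong) (simp_all add: \<nu>_def)
  have YP: "Y \<in> M \<rightarrow>\<^sub>M P" using Y measurable_cong_sets[OF refl sets_P] by blast
  have law_P: "distr M P Y = P"
    using law distr_cong[OF refl sets_P, of M Y Y] by simp
  have E: "?E \<in> sets M"
  proof -
    have "Y -` {x. x Found = real n} \<inter> space M \<in> sets M" using YP found by (rule measurable_sets)
    also have "Y -` {x. x Found = real n} \<inter> space M = ?E" using E_Y by blast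
    finally show ?thesis .
  qed
  have em: "emeasure P {x. x Found = real n} = emeasure M ?E"
  proof -
    have "Y -` {x. x Found = real n} \<inter> space M = ?E" using E_Y by blast
    then show ?thesis using emeasure_distr[OF YP found] by (simp add: law_P)
  qed
  have pos: "emeasure M ?E \<noteq> 0"
  proof -
    obtain p where p: "stationary_queue_length lam mu q p" "measure M {\<omega> \<in> space M. N \<omega> = n} = pmf p n"
      using stationary by blast
    show ?thesis unfolding E_eq emeasure_M p(2)
      using stationary_pmf_pos[OF p(1), of n] assms by simp
  qed
  have "AE \<omega> in M. sojourn_time n (ia (Y \<omega>)) (srv (Y \<omega>)) (dep (Y \<omega>)) = total_service n (Y \<omega>)"
    by (rule AE_distrD[OF YP]) (use AE_sojourn_time[of n] in \<open>simp only: law_P\<close>)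
  then have "AE \<omega> in uniform_measure M ?E. sojourn N A S D \<omega> = total_service n (Y \<omega>)"
    by (intro AE_uniform_measureI[OF E])
       (auto elim!: eventually_mono simp: sojourn_def E_eq Y_def X_def)
  then have "cond_expectation_event M (sojourn N A S D) ?E
      = (\<integral>\<^sup>+\<omega>. total_service n (Y \<omega>) \<partial>uniform_measure M ?E)"
    unfolding cond_expectation_event_def by (rule nn_integral_cong_AE)
  also have "\<dots> = (\<integral>\<^sup>+\<omega>. total_service n (Y \<omega>) * indicator ?E \<omega> \<partial>M) / emeasure M ?E"
    using measurable_compose[OF YP measurable_total_service] E by (rule nn_integral_uniform_measure)
  also have "(\<integral>\<^sup>+\<omega>. total_service n (Y \<omega>) * indicator ?E \<omega> \<partial>M)
      = (\<integral>\<^sup>+\<omega>. total_service n (Y \<omega>) * indicator {x. x Found = real n} (Y \<omega>) \<partial>M)"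
    using E_Y by (intro nn_integral_cong) (simp add: indicator_def)
  also have "\<dots> = (\<integral>\<^sup>+x. total_service n x * indicator {x. x Found = real n} x \<partial>distr M P Y)"
    using YP found by (subst nn_integral_distr) (auto intro!: borel_measurable_times)
  also have "\<dots> = ennreal ((real n + 2 - q) * weight) * emeasure M ?E"
    unfolding law_P nn_integral_total_service_found em ..
  also have "\<dots> / emeasure M ?E = ennreal ((real n + 2 - q) * weight)"
    using pos by (simp add: ennreal_mult_divide_eq emeasure_M)
  finally show ?thesis by (simp add: i weight_def algebra_simps)
qed

end
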